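(* Let $R$ be a commutative Noetherian ring with no embedded primes, let $M$ be an $R$-module, and let $W$ be a multiplicative subset of $R$. If $M$ is divisible over $R$, then $W^{-1}M$ is divisible over $W^{-1}R$. Likewise, if $M$ is h-divisible over $R$, then $W^{-1}M$ is h-divisible over $W^{-1}R$.
   Context: All rings are commutative with identity. $R$ has no embedded primes if every associated prime of $R$ is a minimal prime. For a commutative ring $A$ with total quotient ring $Q(A)$ (the localization at the set of all non-zerodivisors of $A$), an $A$-module $N$ is divisible if every non-zerodivisor of $A$ acts surjectively on $N$, and h-divisible if $N$ is an $A$-module quotient of a free $Q(A)$-module. The case $0\in W$ is allowed; then $W^{-1}R$ is the zero ring, whose only module $0$ is regarded as divisible and h-divisible. *)

theory Defs
  imports "HOL-Algebra.Module" "HOL-Algebra.Ring_Divisibility"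
begin

section \<open>Associated and minimal primes\<close>

definition annihilator :: "('a, 'm) ring_scheme \<Rightarrow> 'a \<Rightarrow> 'a set" where
  "annihilator R x = {r \<in> carrier R. r \<otimes>\<^bsub>R\<^esub> x = \<zero>\<^bsub>R\<^esub>}"

definition associated_prime :: "('a, 'm) ring_scheme \<Rightarrow> 'a set \<Rightarrow> bool" where
  "associated_prime R P \<longleftrightarrow> primeideal P R \<and> (\<exists>x\<in>carrier R. P = annihilator R x)"

definition minimal_prime :: "('a, 'm) ring_scheme \<Rightarrow> 'a set \<Rightarrow> bool" where
  "minimal_prime R P \<longleftrightarrow> primeideal P R \<and> (\<forall>Q. primeideal Q R \<and> Q \<subseteq> P \<longrightarrow> Q = P)"

definition no_embedded_primes :: "('a, 'm) ring_scheme \<Rightarrow> bool" where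
  "no_embedded_primes R \<longleftrightarrow> (\<forall>P. associated_prime R P \<longrightarrow> minimal_prime R P)"


section \<open>Localization\<close>

text \<open>Here and below, the fields \<open>mult\<close> and \<open>one\<close>, which the record type of modules inherits from
  the record type of rings, carry no information and are left undefined.\<close>

definition fraction_rel ::
    "'a set \<Rightarrow> ('a, 'm) ring_scheme \<Rightarrow> ('a, 'b, 'n) module_scheme \<Rightarrow> (('b \<times> 'a) \<times> ('b \<times> 'a)) set" where
  "fraction_rel W R M = {((x, s), (y, t)). x \<in> carrier M \<and> s \<in> W \<and> y \<in> carrier M \<and> t \<in> W \<and>
     (\<exists>u\<in>W. u \<odot>\<^bsub>M\<^esub> (t \<odot>\<^bsub>M\<^esub> x) = u \<odot>\<^bsub>M\<^esub> (s \<odot>\<^bsub>M\<^esub> y))}"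

definition fraction ::
    "'a set \<Rightarrow> ('a, 'm) ring_scheme \<Rightarrow> ('a, 'b, 'n) module_scheme \<Rightarrow> 'b \<Rightarrow> 'a \<Rightarrow> ('b \<times> 'a) set" where
  "fraction W R M x s = fraction_rel W R M `` {(x, s)}"

text \<open>In a localization \<open>W\<inverse>M\<close>, \<open>x/s + y/t = (t x + s y)/(s t)\<close> and \<open>(a/s) (x/t) = (a x)/(s t)\<close>.
  As usual for quotients, an operation is defined as the union of its results over all
  representatives; these results coincide, see \<open>fraction_add\<close> and \<open>fraction_smult\<close> below.\<close>

definition localize_module ::
    "'a set \<Rightarrow> ('a, 'm) ring_scheme \<Rightarrow> ('a, 'b, 'n) module_scheme \<Rightarrow> (('a \<times> 'a) set, ('b \<times> 'a) set) module" where
  "localize_module W R M =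
     \<lparr>carrier = (carrier M \<times> W) // fraction_rel W R M,
      mult = undefined, one = undefined,
      zero = fraction W R M \<zero>\<^bsub>M\<^esub> \<one>\<^bsub>R\<^esub>,
      add = (\<lambda>p q. \<Union>(x, s)\<in>p. \<Union>(y, t)\<in>q. fraction W R M (t \<odot>\<^bsub>M\<^esub> x \<oplus>\<^bsub>M\<^esub> s \<odot>\<^bsub>M\<^esub> y) (s \<otimes>\<^bsub>R\<^esub> t)),
      smult = (\<lambda>q p. \<Union>(a, s)\<in>q. \<Union>(x, t)\<in>p. fraction W R M (a \<odot>\<^bsub>M\<^esub> x) (s \<otimes>\<^bsub>R\<^esub> t))\<rparr>"

definition regular_module :: "('a, 'm) ring_scheme \<Rightarrow> ('a, 'a) module" where
  "regular_module R = \<lparr>carrier = carrier R, mult = undefined, one = undefined,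
     zero = \<zero>\<^bsub>R\<^esub>, add = add R, smult = mult R\<rparr>"

text \<open>The ring \<open>W\<inverse>R\<close> is the localization of \<open>R\<close> as a module over itself; its multiplication
  \<open>(a/s) (b/t) = (a b)/(s t)\<close> is the scalar multiplication of that module.\<close>

definition localize_ring :: "'a set \<Rightarrow> ('a, 'm) ring_scheme \<Rightarrow> ('a \<times> 'a) set ring" where
  "localize_ring W R =
     \<lparr>carrier = carrier (localize_module W R (regular_module R)),
      mult = smult (localize_module W R (regular_module R)),
      one = fraction W R (regular_module R) \<one>\<^bsub>R\<^esub> \<one>\<^bsub>R\<^esub>,
      zero = zero (localize_module W R (regular_module R)),
      add = add (localize_module W R (regular_module R))\<rparr>"

definition nonzerodivisors :: "('a, 'm) ring_scheme \<Rightarrow> 'a set" where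
  "nonzerodivisors A = {a \<in> carrier A. \<forall>x\<in>carrier A. a \<otimes>\<^bsub>A\<^esub> x = \<zero>\<^bsub>A\<^esub> \<longrightarrow> x = \<zero>\<^bsub>A\<^esub>}"

definition total_quotient_ring :: "('a, 'm) ring_scheme \<Rightarrow> ('a \<times> 'a) set ring" where
  "total_quotient_ring A = localize_ring (nonzerodivisors A) A"

definition to_total_quotient_ring :: "('a, 'm) ring_scheme \<Rightarrow> 'a \<Rightarrow> ('a \<times> 'a) set" where
  "to_total_quotient_ring A a = fraction (nonzerodivisors A) A (regular_module A) a \<one>\<^bsub>A\<^esub>"


section \<open>Divisible and h-divisible modules\<close>

definition divisible :: "('a, 'm) ring_scheme \<Rightarrow> ('a, 'b, 'n) module_scheme \<Rightarrow> bool" where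
  "divisible A N \<longleftrightarrow> (\<forall>a\<in>nonzerodivisors A. (\<lambda>x. a \<odot>\<^bsub>N\<^esub> x) ` carrier N = carrier N)"

definition module_hom ::
    "('a, 'm) ring_scheme \<Rightarrow> ('a, 'b, 'n) module_scheme \<Rightarrow> ('a, 'c, 'p) module_scheme \<Rightarrow> ('b \<Rightarrow> 'c) set" where
  "module_hom A M N = {f \<in> carrier M \<rightarrow> carrier N.
     (\<forall>x\<in>carrier M. \<forall>y\<in>carrier M. f (x \<oplus>\<^bsub>M\<^esub> y) = f x \<oplus>\<^bsub>N\<^esub> f y) \<and>
     (\<forall>a\<in>carrier A. \<forall>x\<in>carrier M. f (a \<odot>\<^bsub>M\<^esub> x) = a \<odot>\<^bsub>N\<^esub> f x)}"

definition restrict_scalars ::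
    "('a \<Rightarrow> 'q) \<Rightarrow> ('q, 'b, 'n) module_scheme \<Rightarrow> ('a, 'b) module" where
  "restrict_scalars h M = \<lparr>carrier = carrier M, mult = undefined, one = undefined,
     zero = \<zero>\<^bsub>M\<^esub>, add = add M, smult = (\<lambda>a x. h a \<odot>\<^bsub>M\<^esub> x)\<rparr>"

text \<open>The free module with basis indexed by \<open>I\<close>: finitely supported families in \<open>Q\<close>.\<close>

definition free_module :: "('q, 'm) ring_scheme \<Rightarrow> 'i set \<Rightarrow> ('q, 'i \<Rightarrow> 'q) module" where
  "free_module Q I =
     \<lparr>carrier = {v \<in> I \<rightarrow>\<^sub>E carrier Q. finite {i \<in> I. v i \<noteq> \<zero>\<^bsub>Q\<^esub>}},
      mult = undefined, one = undefined,
      zero = (\<lambda>i\<in>I. \<zero>\<^bsub>Q\<^esub>),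
      add = (\<lambda>v w. \<lambda>i\<in>I. v i \<oplus>\<^bsub>Q\<^esub> w i),
      smult = (\<lambda>q v. \<lambda>i\<in>I. q \<otimes>\<^bsub>Q\<^esub> v i)\<rparr>"

text \<open>A quotient of a module is, up to isomorphism, the target of a surjective homomorphism.
  HOL does not allow quantification over the type of the index set \<open>I\<close>, so \<open>I\<close> is drawn from the
  element type of \<open>N\<close>. This is no restriction: by \<open>h_divisibleI\<close> below, \<open>N\<close> is h-divisible as soon
  as it is a quotient of a free \<open>Q(A)\<close>-module (in fact of any \<open>Q(A)\<close>-module) of any type.\<close>

definition h_divisible :: "('a, 'm) ring_scheme \<Rightarrow> ('a, 'b, 'n) module_scheme \<Rightarrow> bool" where
  "h_divisible A N \<longleftrightarrow>
     (\<exists>(I :: 'b set) f.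
        f \<in> module_hom A (restrict_scalars (to_total_quotient_ring A) (free_module (total_quotient_ring A) I)) N \<and>
        f ` carrier (free_module (total_quotient_ring A) I) = carrier N)"


section \<open>The constructions are well-defined\<close>

lemma UN_UN_const:
  assumes "(a0, b0) \<in> p" "(c0, d0) \<in> q"
    and "\<And>a b c d. \<lbrakk>(a, b) \<in> p; (c, d) \<in> q\<rbrakk> \<Longrightarrow> F a b c d = C"
  shows "(\<Union>(a, b)\<in>p. \<Union>(c, d)\<in>q. F a b c d) = C"
proof -
  have "(\<Union>(a, b)\<in>p. \<Union>(c, d)\<in>q. F a b c d) = (\<Union>(a, b)\<in>p. \<Union>(c, d)\<in>q. C)"
    using assms(3) by (intro SUP_cong refl) auto
  then show ?thesis using assms(1,2) by auto
qed

lemma abelian_group_transfer: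
  assumes "abelian_group G" "carrier H = carrier G" "\<zero>\<^bsub>H\<^esub> = \<zero>\<^bsub>G\<^esub>" "add H = add G"
  shows "abelian_group H"
proof -
  interpret abelian_group G by fact
  show ?thesis
  proof (rule abelian_groupI)
    fix x assume "x \<in> carrier H"
    then show "\<exists>y\<in>carrier H. y \<oplus>\<^bsub>H\<^esub> x = \<zero>\<^bsub>H\<^esub>"
      by (intro bexI[of _ "\<ominus>\<^bsub>G\<^esub> x"]) (simp_all add: assms(2-4) l_neg)
  qed (simp_all add: assms(2-4) a_ac)
qed

lemma module_regular_module:
  assumes "cring R" shows "module R (regular_module R)"
proof -
  interpret cring R by fact
  show ?thesis
  proof (rule moduleI[OF assms])
    show "abelian_group (regular_module R)"
      by (rule abelian_group_transfer[OF abelian_group_axioms]) (simp_all add: regular_module_def)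
  qed (simp_all add: regular_module_def l_distr r_distr m_assoc)
qed

lemma submonoid_nonzerodivisors:
  assumes "cring A" shows "submonoid (nonzerodivisors A) A"
proof -
  interpret cring A by fact
  show ?thesis
  proof (rule submonoid.intro)
    fix a b assume ab: "a \<in> nonzerodivisors A" "b \<in> nonzerodivisors A"
    have "x = \<zero>\<^bsub>A\<^esub>" if x: "x \<in> carrier A" "a \<otimes>\<^bsub>A\<^esub> b \<otimes>\<^bsub>A\<^esub> x = \<zero>\<^bsub>A\<^esub>" for x
    proof -
      have "a \<otimes>\<^bsub>A\<^esub> (b \<otimes>\<^bsub>A\<^esub> x) = \<zero>\<^bsub>A\<^esub>"
        using ab x by (subst m_assoc[symmetric]) (unfold nonzerodivisors_def, blast+)
      then have "b \<otimes>\<^bsub>A\<^esub> x = \<zero>\<^bsub>A\<^esub>"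
        using ab x(1) m_closed unfolding nonzerodivisors_def by blast
      then show ?thesis
        using ab x(1) unfolding nonzerodivisors_def by blast
    qed
    then show "a \<otimes>\<^bsub>A\<^esub> b \<in> nonzerodivisors A"
      using ab m_closed unfolding nonzerodivisors_def by blast
  next
    show "\<one>\<^bsub>A\<^esub> \<in> nonzerodivisors A"
      by (simp add: nonzerodivisors_def)
    show "nonzerodivisors A \<subseteq> carrier A"
      by (auto simp: nonzerodivisors_def)
  qed
qed

locale module_fractions = module R M + submonoid W R for R (structure) and M (structure) and W
begin

lemma W_carrier [simp]: "s \<in> W \<Longrightarrow> s \<in> carrier R"
  using subset by blast

lemma smult_left_commute:
  "\<lbrakk>a \<in> carrier R; b \<in> carrier R; x \<in> carrier M\<rbrakk> \<Longrightarrow> a \<odot>\<^bsub>M\<^esub> (b \<odot>\<^bsub>M\<^esub> x) = b \<odot>\<^bsub>M\<^esub> (a \<odot>\<^bsub>M\<^esub> x)"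
  by (metis smult_assoc1 R.m_comm)

lemma equiv_fraction_rel: "equiv (carrier M \<times> W) (fraction_rel W R M)"
proof (rule equivI)
  show "fraction_rel W R M \<subseteq> (carrier M \<times> W) \<times> carrier M \<times> W"
    by (auto simp: fraction_rel_def)
  show "refl_on (carrier M \<times> W) (fraction_rel W R M)"
    using one_closed by (auto simp: fraction_rel_def refl_on_def)
  show "sym (fraction_rel W R M)"
    by (auto simp: fraction_rel_def sym_def) metis
  show "trans (fraction_rel W R M)"
  proof (rule transI, clarify)
    fix x s y t z r
    assume "((x, s), (y, t)) \<in> fraction_rel W R M" "((y, t), (z, r)) \<in> fraction_rel W R M"
    then obtain u v where c: "x \<in> carrier M" "y \<in> carrier M" "z \<in> carrier M" "s \<in> W" "t \<in> W" "r \<in> W"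
        "u \<in> W" "v \<in> W"
      and u: "u \<odot>\<^bsub>M\<^esub> (t \<odot>\<^bsub>M\<^esub> x) = u \<odot>\<^bsub>M\<^esub> (s \<odot>\<^bsub>M\<^esub> y)"
      and v: "v \<odot>\<^bsub>M\<^esub> (r \<odot>\<^bsub>M\<^esub> y) = v \<odot>\<^bsub>M\<^esub> (t \<odot>\<^bsub>M\<^esub> z)"
      by (auto simp: fraction_rel_def)
    let ?w = "u \<otimes> v \<otimes> t"
    have "?w \<odot>\<^bsub>M\<^esub> (r \<odot>\<^bsub>M\<^esub> x) = v \<odot>\<^bsub>M\<^esub> (r \<odot>\<^bsub>M\<^esub> (u \<odot>\<^bsub>M\<^esub> (t \<odot>\<^bsub>M\<^esub> x)))"
      using c by (simp add: smult_assoc1 smult_left_commute)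
    also have "\<dots> = u \<odot>\<^bsub>M\<^esub> (s \<odot>\<^bsub>M\<^esub> (v \<odot>\<^bsub>M\<^esub> (r \<odot>\<^bsub>M\<^esub> y)))"
      unfolding u using c by (simp add: smult_assoc1 smult_left_commute)
    also have "\<dots> = ?w \<odot>\<^bsub>M\<^esub> (s \<odot>\<^bsub>M\<^esub> z)"
      unfolding v using c by (simp add: smult_assoc1 smult_left_commute)
    finally show "((x, s), (z, r)) \<in> fraction_rel W R M"
      using c by (auto simp: fraction_rel_def intro!: bexI[of _ ?w])
  qed
qed

lemma fraction_eq_iff:
  assumes "x \<in> carrier M" "y \<in> carrier M" "s \<in> W" "t \<in> W"
  shows "fraction W R M x s = fraction W R M y t \<longleftrightarrow> (\<exists>u\<in>W. u \<odot>\<^bsub>M\<^esub> (t \<odot>\<^bsub>M\<^esub> x) = u \<odot>\<^bsub>M\<^esub> (s \<odot>\<^bsub>M\<^esub> y))"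
  unfolding fraction_def using assms
  by (subst eq_equiv_class_iff[OF equiv_fraction_rel]) (auto simp: fraction_rel_def)

lemma fraction_cong:
  assumes "x \<in> carrier M" "y \<in> carrier M" "s \<in> W" "t \<in> W" "t \<odot>\<^bsub>M\<^esub> x = s \<odot>\<^bsub>M\<^esub> y"
  shows "fraction W R M x s = fraction W R M y t"
  using assms one_closed by (auto simp: fraction_eq_iff)

lemma fraction_carrier [simp]:
  "\<lbrakk>x \<in> carrier M; s \<in> W\<rbrakk> \<Longrightarrow> fraction W R M x s \<in> carrier (localize_module W R M)"
  by (auto simp: localize_module_def fraction_def intro!: quotientI)

lemma fraction_cases:
  assumes "p \<in> carrier (localize_module W R M)"
  obtains x s where "x \<in> carrier M" "s \<in> W" "p = fraction W R M x s"
  using assms by (auto simp: localize_module_def fraction_def elim!: quotientE)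

lemma in_fraction_iff:
  assumes "x \<in> carrier M" "s \<in> W"
  shows "(y, t) \<in> fraction W R M x s \<longleftrightarrow> y \<in> carrier M \<and> t \<in> W \<and> fraction W R M y t = fraction W R M x s"
proof -
  have "(y, t) \<in> fraction W R M x s \<longleftrightarrow> y \<in> carrier M \<and> t \<in> W \<and> fraction W R M x s = fraction W R M y t"
    using assms by (subst conj_cong[OF refl conj_cong[OF refl fraction_eq_iff]])
      (auto simp: fraction_def fraction_rel_def)
  then show ?thesis by (metis (full_types))
qed

lemma in_fractionE:
  assumes "(y, t) \<in> fraction W R M x s" "x \<in> carrier M" "s \<in> W"
  obtains u where "y \<in> carrier M" "t \<in> W" "u \<in> W" "u \<odot>\<^bsub>M\<^esub> (s \<odot>\<^bsub>M\<^esub> y) = u \<odot>\<^bsub>M\<^esub> (t \<odot>\<^bsub>M\<^esub> x)"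
  using assms by (auto simp: in_fraction_iff fraction_eq_iff)

lemma fraction_self: "\<lbrakk>x \<in> carrier M; s \<in> W\<rbrakk> \<Longrightarrow> (x, s) \<in> fraction W R M x s"
  by (simp add: in_fraction_iff)

lemma fraction_add:
  assumes "x \<in> carrier M" "y \<in> carrier M" "s \<in> W" "t \<in> W"
  shows "fraction W R M x s \<oplus>\<^bsub>localize_module W R M\<^esub> fraction W R M y t =
    fraction W R M (t \<odot>\<^bsub>M\<^esub> x \<oplus>\<^bsub>M\<^esub> s \<odot>\<^bsub>M\<^esub> y) (s \<otimes> t)" (is "_ = ?F")
proof -
  have *: "fraction W R M (t' \<odot>\<^bsub>M\<^esub> x' \<oplus>\<^bsub>M\<^esub> s' \<odot>\<^bsub>M\<^esub> y') (s' \<otimes> t') = ?F"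
    if xs: "(x', s') \<in> fraction W R M x s" and yt: "(y', t') \<in> fraction W R M y t" for x' s' y' t'
  proof -
    from xs obtain u where xs': "x' \<in> carrier M" "s' \<in> W" "u \<in> W"
      and u: "u \<odot>\<^bsub>M\<^esub> (s \<odot>\<^bsub>M\<^esub> x') = u \<odot>\<^bsub>M\<^esub> (s' \<odot>\<^bsub>M\<^esub> x)"
      by (rule in_fractionE[OF _ assms(1,3)])
    from yt obtain v where yt': "y' \<in> carrier M" "t' \<in> W" "v \<in> W"
      and v: "v \<odot>\<^bsub>M\<^esub> (t \<odot>\<^bsub>M\<^esub> y') = v \<odot>\<^bsub>M\<^esub> (t' \<odot>\<^bsub>M\<^esub> y)"
      by (rule in_fractionE[OF _ assms(2,4)])
    note c = assms xs' yt'
    have "(u \<otimes> v) \<odot>\<^bsub>M\<^esub> ((s \<otimes> t) \<odot>\<^bsub>M\<^esub> (t' \<odot>\<^bsub>M\<^esub> x' \<oplus>\<^bsub>M\<^esub> s' \<odot>\<^bsub>M\<^esub> y')) =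
        v \<odot>\<^bsub>M\<^esub> (t \<odot>\<^bsub>M\<^esub> (t' \<odot>\<^bsub>M\<^esub> (u \<odot>\<^bsub>M\<^esub> (s \<odot>\<^bsub>M\<^esub> x')))) \<oplus>\<^bsub>M\<^esub> u \<odot>\<^bsub>M\<^esub> (s \<odot>\<^bsub>M\<^esub> (s' \<odot>\<^bsub>M\<^esub> (v \<odot>\<^bsub>M\<^esub> (t \<odot>\<^bsub>M\<^esub> y'))))"
      using c by (simp add: smult_assoc1 smult_r_distr smult_left_commute)
    also have "\<dots> = (u \<otimes> v) \<odot>\<^bsub>M\<^esub> ((s' \<otimes> t') \<odot>\<^bsub>M\<^esub> (t \<odot>\<^bsub>M\<^esub> x \<oplus>\<^bsub>M\<^esub> s \<odot>\<^bsub>M\<^esub> y))"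
      unfolding u v using c by (simp add: smult_assoc1 smult_r_distr smult_left_commute)
    finally show ?thesis
      using c by (subst fraction_eq_iff) auto
  qed
  show ?thesis
    unfolding localize_module_def using assms
    by (simp, intro UN_UN_const[OF fraction_self fraction_self]) (use * in auto)
qed

lemma regular: "module_fractions R (regular_module R) W"
  by (simp add: module_fractions_def module_regular_module R.cring_axioms submonoid_axioms)

lemma carrier_regular [simp]: "carrier (regular_module R) = carrier R"
  by (simp add: regular_module_def)

lemma fraction_smult:
  assumes "a \<in> carrier R" "x \<in> carrier M" "s \<in> W" "t \<in> W"
  shows "fraction W R (regular_module R) a s \<odot>\<^bsub>localize_module W R M\<^esub> fraction W R M x t =
    fraction W R M (a \<odot>\<^bsub>M\<^esub> x) (s \<otimes> t)" (is "_ = ?F")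
proof -
  note self = module_fractions.fraction_self[OF regular] fraction_self
  have *: "fraction W R M (a' \<odot>\<^bsub>M\<^esub> x') (s' \<otimes> t') = ?F"
    if as: "(a', s') \<in> fraction W R (regular_module R) a s" and xt: "(x', t') \<in> fraction W R M x t"
    for a' s' x' t'
  proof -
    from as obtain u where as': "a' \<in> carrier R" "s' \<in> W" "u \<in> W"
      and u: "u \<otimes> (s \<otimes> a') = u \<otimes> (s' \<otimes> a)"
      by (rule module_fractions.in_fractionE[OF regular, of _ _ a s])
        (use assms in \<open>simp_all add: regular_module_def\<close>)
    from xt obtain v where xt': "x' \<in> carrier M" "t' \<in> W" "v \<in> W"
      and v: "v \<odot>\<^bsub>M\<^esub> (t \<odot>\<^bsub>M\<^esub> x') = v \<odot>\<^bsub>M\<^esub> (t' \<odot>\<^bsub>M\<^esub> x)"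
      by (rule in_fractionE[OF _ assms(2,4)])
    note c = assms as' xt'
    have "(u \<otimes> v) \<odot>\<^bsub>M\<^esub> ((s \<otimes> t) \<odot>\<^bsub>M\<^esub> (a' \<odot>\<^bsub>M\<^esub> x')) = (u \<otimes> (s \<otimes> a')) \<odot>\<^bsub>M\<^esub> (v \<odot>\<^bsub>M\<^esub> (t \<odot>\<^bsub>M\<^esub> x'))"
      using c by (simp add: smult_assoc1 smult_left_commute)
    also have "\<dots> = (u \<otimes> v) \<odot>\<^bsub>M\<^esub> ((s' \<otimes> t') \<odot>\<^bsub>M\<^esub> (a \<odot>\<^bsub>M\<^esub> x))"
      unfolding u v using c by (simp add: smult_assoc1 smult_left_commute)
    finally show ?thesis
      using c by (subst fraction_eq_iff) auto
  qed
  show ?thesis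
    unfolding localize_module_def using assms
    by (simp, intro UN_UN_const[OF self]) (use * in auto)
qed

lemma zero_localize: "\<zero>\<^bsub>localize_module W R M\<^esub> = fraction W R M \<zero>\<^bsub>M\<^esub> \<one>"
  by (simp add: localize_module_def)

lemma abelian_group_localize_module: "abelian_group (localize_module W R M)"
proof (rule abelian_groupI)
  let ?L = "localize_module W R M"
  show "\<zero>\<^bsub>?L\<^esub> \<in> carrier ?L"
    using one_closed by (simp add: zero_localize)
  fix p assume "p \<in> carrier ?L"
  then obtain x s where x: "x \<in> carrier M" "s \<in> W" "p = fraction W R M x s" by (rule fraction_cases)
  show "\<zero>\<^bsub>?L\<^esub> \<oplus>\<^bsub>?L\<^esub> p = p"
    using x one_closed by (simp add: zero_localize fraction_add)
  have "fraction W R M (\<ominus>\<^bsub>M\<^esub> x) s \<oplus>\<^bsub>?L\<^esub> p = \<zero>\<^bsub>?L\<^esub>"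
    using x one_closed
    by (simp add: zero_localize fraction_add smult_r_minus M.l_neg) (rule fraction_cong; simp)
  then show "\<exists>y\<in>carrier ?L. y \<oplus>\<^bsub>?L\<^esub> p = \<zero>\<^bsub>?L\<^esub>"
    using x by (auto intro!: bexI[of _ "fraction W R M (\<ominus>\<^bsub>M\<^esub> x) s"])
  fix q assume "q \<in> carrier ?L"
  then obtain y t where y: "y \<in> carrier M" "t \<in> W" "q = fraction W R M y t" by (rule fraction_cases)
  show "p \<oplus>\<^bsub>?L\<^esub> q \<in> carrier ?L"
    using x y by (simp add: fraction_add)
  show "p \<oplus>\<^bsub>?L\<^esub> q = q \<oplus>\<^bsub>?L\<^esub> p"
    using x y by (simp add: fraction_add M.a_comm R.m_comm)
  fix r assume "r \<in> carrier ?L"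
  then obtain z u where z: "z \<in> carrier M" "u \<in> W" "r = fraction W R M z u" by (rule fraction_cases)
  show "p \<oplus>\<^bsub>?L\<^esub> q \<oplus>\<^bsub>?L\<^esub> r = p \<oplus>\<^bsub>?L\<^esub> (q \<oplus>\<^bsub>?L\<^esub> r)"
    using x y z
    by (simp add: fraction_add smult_r_distr smult_assoc1 smult_left_commute M.a_assoc R.m_assoc)
qed

lemma smult_localize:
  fixes L K
  defines "L \<equiv> localize_module W R M" and "K \<equiv> localize_module W R (regular_module R)"
  assumes a: "a \<in> carrier K" and p: "p \<in> carrier L"
  shows "a \<odot>\<^bsub>L\<^esub> p \<in> carrier L"
    and "b \<in> carrier K \<Longrightarrow> (a \<oplus>\<^bsub>K\<^esub> b) \<odot>\<^bsub>L\<^esub> p = a \<odot>\<^bsub>L\<^esub> p \<oplus>\<^bsub>L\<^esub> b \<odot>\<^bsub>L\<^esub> p"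
    and "q \<in> carrier L \<Longrightarrow> a \<odot>\<^bsub>L\<^esub> (p \<oplus>\<^bsub>L\<^esub> q) = a \<odot>\<^bsub>L\<^esub> p \<oplus>\<^bsub>L\<^esub> a \<odot>\<^bsub>L\<^esub> q"
    and "b \<in> carrier K \<Longrightarrow> (a \<odot>\<^bsub>K\<^esub> b) \<odot>\<^bsub>L\<^esub> p = a \<odot>\<^bsub>L\<^esub> (b \<odot>\<^bsub>L\<^esub> p)"
proof -
  interpret S: module_fractions R "regular_module R" W
    by (rule regular)
  have reg [simp]: "add (regular_module R) = add R" "smult (regular_module R) = mult R"
    by (simp_all add: regular_module_def)
  obtain x s where x: "x \<in> carrier M" "s \<in> W" "p = fraction W R M x s"
    using p unfolding L_def by (rule fraction_cases)
  obtain c u where c: "c \<in> carrier R" "u \<in> W" "a = fraction W R (regular_module R) c u"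
    using a unfolding K_def by (rule S.fraction_cases) simp
  note sms = L_def K_def fraction_add fraction_smult S.fraction_add S.fraction_smult
  show "a \<odot>\<^bsub>L\<^esub> p \<in> carrier L"
    using x c by (simp add: sms)
  show "(a \<oplus>\<^bsub>K\<^esub> b) \<odot>\<^bsub>L\<^esub> p = a \<odot>\<^bsub>L\<^esub> p \<oplus>\<^bsub>L\<^esub> b \<odot>\<^bsub>L\<^esub> p" if b: "b \<in> carrier K"
  proof -
    obtain d v where d: "d \<in> carrier R" "v \<in> W" "b = fraction W R (regular_module R) d v"
      using b unfolding K_def by (rule S.fraction_cases) simp
    show ?thesis
      using x c d
      by (simp add: sms) (rule fraction_cong; simp add: smult_r_distr smult_l_distr smult_assoc1 smult_left_commute)
  qed
  show "a \<odot>\<^bsub>L\<^esub> (p \<oplus>\<^bsub>L\<^esub> q) = a \<odot>\<^bsub>L\<^esub> p \<oplus>\<^bsub>L\<^esub> a \<odot>\<^bsub>L\<^esub> q" if q: "q \<in> carrier L"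
  proof -
    obtain y t where y: "y \<in> carrier M" "t \<in> W" "q = fraction W R M y t"
      using q unfolding L_def by (rule fraction_cases)
    show ?thesis
      using x y c
      by (simp add: sms) (rule fraction_cong; simp add: smult_r_distr smult_l_distr smult_assoc1 smult_left_commute)
  qed
  show "(a \<odot>\<^bsub>K\<^esub> b) \<odot>\<^bsub>L\<^esub> p = a \<odot>\<^bsub>L\<^esub> (b \<odot>\<^bsub>L\<^esub> p)" if b: "b \<in> carrier K"
  proof -
    obtain d v where d: "d \<in> carrier R" "v \<in> W" "b = fraction W R (regular_module R) d v"
      using b unfolding K_def by (rule S.fraction_cases) simp
    show ?thesis
      using x c d by (simp add: sms smult_assoc1 R.m_assoc)
  qed
qed

lemma one_smult_localize:
  assumes "p \<in> carrier (localize_module W R M)"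
  shows "fraction W R (regular_module R) \<one> \<one> \<odot>\<^bsub>localize_module W R M\<^esub> p = p"
  using assms by (elim fraction_cases) (simp add: fraction_smult)

lemma cring_localize_ring: "cring (localize_ring W R)"
proof -
  interpret S: module_fractions R "regular_module R" W
    by (rule regular)
  let ?K = "localize_module W R (regular_module R)"
  have comm: "a \<odot>\<^bsub>?K\<^esub> b = b \<odot>\<^bsub>?K\<^esub> a" if "a \<in> carrier ?K" "b \<in> carrier ?K" for a b
    using that
    by (elim S.fraction_cases)
      (simp add: S.fraction_smult R.m_comm, simp add: regular_module_def R.m_comm)
  have one: "fraction W R (regular_module R) \<one> \<one> \<in> carrier ?K"
    by (rule S.fraction_carrier) simp_all
  interpret K: abelian_group ?K
    by (rule S.abelian_group_localize_module)
  show ?thesis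
  proof (rule cringI)
    show "abelian_group (localize_ring W R)"
      by (rule abelian_group_transfer[OF K.abelian_group_axioms]) (simp_all add: localize_ring_def)
    show "comm_monoid (localize_ring W R)"
      by (rule comm_monoidI; unfold localize_ring_def ring_record_simps)
        (fact one | (rule S.smult_localize(1,4) S.one_smult_localize comm; assumption))+
  qed (unfold localize_ring_def ring_record_simps, rule S.smult_localize(2); assumption)
qed

lemma module_localize_module: "module (localize_ring W R) (localize_module W R M)"
  by (rule moduleI[OF cring_localize_ring abelian_group_localize_module];
      unfold localize_ring_def ring_record_simps)
    ((rule smult_localize one_smult_localize; assumption)+)

end

lemma module_fractions_nonzerodivisors:
  assumes "cring A" shows "module_fractions A (regular_module A) (nonzerodivisors A)"
  using module_regular_module[OF assms] submonoid_nonzerodivisors[OF assms]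
  by (rule module_fractions.intro)

lemma cring_total_quotient_ring:
  assumes "cring A" shows "cring (total_quotient_ring A)"
  unfolding total_quotient_ring_def
  using module_fractions_nonzerodivisors[OF assms] by (rule module_fractions.cring_localize_ring)

lemma to_total_quotient_ring_closed:
  assumes "cring A" "a \<in> carrier A"
  shows "to_total_quotient_ring A a \<in> carrier (total_quotient_ring A)"
proof -
  interpret module_fractions A "regular_module A" "nonzerodivisors A"
    using assms(1) by (rule module_fractions_nonzerodivisors)
  show ?thesis
    using assms by (simp add: total_quotient_ring_def to_total_quotient_ring_def localize_ring_def)
qed

lemma module_free_module:
  assumes "cring Q" shows "module Q (free_module Q I)"
proof -
  interpret cring Q by fact
  have fin: "finite {i \<in> I. h i \<noteq> \<zero>\<^bsub>Q\<^esub>}"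
    if "finite {i \<in> I. f i \<noteq> \<zero>\<^bsub>Q\<^esub>}" "finite {i \<in> I. g i \<noteq> \<zero>\<^bsub>Q\<^esub>}"
      "\<And>i. \<lbrakk>i \<in> I; f i = \<zero>\<^bsub>Q\<^esub>; g i = \<zero>\<^bsub>Q\<^esub>\<rbrakk> \<Longrightarrow> h i = \<zero>\<^bsub>Q\<^esub>" for f g h
    by (rule finite_subset[OF _ finite_UnI[OF that(1,2)]]) (use that(3) in auto)
  have add: "(\<lambda>i\<in>I. f i \<oplus>\<^bsub>Q\<^esub> g i) \<in> carrier (free_module Q I)"
    if "f \<in> carrier (free_module Q I)" "g \<in> carrier (free_module Q I)" for f g
  proof -
    have "finite {i \<in> I. (\<lambda>i\<in>I. f i \<oplus>\<^bsub>Q\<^esub> g i) i \<noteq> \<zero>\<^bsub>Q\<^esub>}"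
      by (rule fin[of f g]) (use that in \<open>auto simp: free_module_def\<close>)
    then show ?thesis using that by (auto simp: free_module_def PiE_iff)
  qed
  have smult: "(\<lambda>i\<in>I. a \<otimes>\<^bsub>Q\<^esub> f i) \<in> carrier (free_module Q I)"
    if "a \<in> carrier Q" "f \<in> carrier (free_module Q I)" for a f
  proof -
    have "finite {i \<in> I. (\<lambda>i\<in>I. a \<otimes>\<^bsub>Q\<^esub> f i) i \<noteq> \<zero>\<^bsub>Q\<^esub>}"
      by (rule fin[of f f]) (use that in \<open>auto simp: free_module_def\<close>)
    then show ?thesis using that by (auto simp: free_module_def PiE_iff)
  qed
  show ?thesis
  proof (rule moduleI[OF assms abelian_groupI])
    fix v assume v: "v \<in> carrier (free_module Q I)"
    have "(\<lambda>i\<in>I. \<ominus>\<^bsub>Q\<^esub> v i) \<in> carrier (free_module Q I)"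
    proof -
      have "finite {i \<in> I. (\<lambda>i\<in>I. \<ominus>\<^bsub>Q\<^esub> v i) i \<noteq> \<zero>\<^bsub>Q\<^esub>}"
        by (rule fin[of v v]) (use v in \<open>auto simp: free_module_def\<close>)
      then show ?thesis using v by (auto simp: free_module_def PiE_iff)
    qed
    moreover have "(\<lambda>i\<in>I. \<ominus>\<^bsub>Q\<^esub> v i) \<oplus>\<^bsub>free_module Q I\<^esub> v = \<zero>\<^bsub>free_module Q I\<^esub>"
      using v by (auto simp: free_module_def PiE_iff l_neg)
    ultimately show "\<exists>w\<in>carrier (free_module Q I). w \<oplus>\<^bsub>free_module Q I\<^esub> v = \<zero>\<^bsub>free_module Q I\<^esub>" by blast
    show "\<zero>\<^bsub>free_module Q I\<^esub> \<oplus>\<^bsub>free_module Q I\<^esub> v = v" "\<one>\<^bsub>Q\<^esub> \<odot>\<^bsub>free_module Q I\<^esub> v = v"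
      using v by (auto simp: free_module_def PiE_iff extensional_def)
    fix w assume w: "w \<in> carrier (free_module Q I)"
    show "v \<oplus>\<^bsub>free_module Q I\<^esub> w \<in> carrier (free_module Q I)"
      using add[OF v w] by (simp add: free_module_def)
    show "v \<oplus>\<^bsub>free_module Q I\<^esub> w = w \<oplus>\<^bsub>free_module Q I\<^esub> v"
      using v w by (auto simp: free_module_def PiE_iff a_comm intro: restrict_ext)
    fix a assume a: "a \<in> carrier Q"
    show "a \<odot>\<^bsub>free_module Q I\<^esub> (v \<oplus>\<^bsub>free_module Q I\<^esub> w) =
        a \<odot>\<^bsub>free_module Q I\<^esub> v \<oplus>\<^bsub>free_module Q I\<^esub> a \<odot>\<^bsub>free_module Q I\<^esub> w"
      using v w a by (auto simp: free_module_def PiE_iff r_distr intro: restrict_ext)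
  next
    fix v a assume v: "v \<in> carrier (free_module Q I)" and a: "a \<in> carrier Q"
    show "a \<odot>\<^bsub>free_module Q I\<^esub> v \<in> carrier (free_module Q I)"
      using smult[OF a v] by (simp add: free_module_def)
    fix b assume b: "b \<in> carrier Q"
    show "(a \<oplus>\<^bsub>Q\<^esub> b) \<odot>\<^bsub>free_module Q I\<^esub> v =
        a \<odot>\<^bsub>free_module Q I\<^esub> v \<oplus>\<^bsub>free_module Q I\<^esub> b \<odot>\<^bsub>free_module Q I\<^esub> v"
      using v a b by (auto simp: free_module_def PiE_iff l_distr intro: restrict_ext)
    show "(a \<otimes>\<^bsub>Q\<^esub> b) \<odot>\<^bsub>free_module Q I\<^esub> v = a \<odot>\<^bsub>free_module Q I\<^esub> (b \<odot>\<^bsub>free_module Q I\<^esub> v)"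
      using v a b by (auto simp: free_module_def PiE_iff m_assoc intro: restrict_ext)
  next
    fix u v w
    assume "u \<in> carrier (free_module Q I)" "v \<in> carrier (free_module Q I)" "w \<in> carrier (free_module Q I)"
    then show "u \<oplus>\<^bsub>free_module Q I\<^esub> v \<oplus>\<^bsub>free_module Q I\<^esub> w =
        u \<oplus>\<^bsub>free_module Q I\<^esub> (v \<oplus>\<^bsub>free_module Q I\<^esub> w)"
      by (auto simp: free_module_def PiE_iff a_assoc intro: restrict_ext)
  qed (simp add: free_module_def)
qed

lemma h_divisibleI:
  fixes A :: "('a, 'm) ring_scheme" and N :: "('a, 'b, 'n) module_scheme"
    and F :: "(('a \<times> 'a) set, 'c, 'p) module_scheme"
  assumes A: "cring A" and N: "module A N" and F: "module (total_quotient_ring A) F"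
    and f: "f \<in> module_hom A (restrict_scalars (to_total_quotient_ring A) F) N"
    and surj: "f ` carrier F = carrier N"
  shows "h_divisible A N"
proof -
  let ?Q = "total_quotient_ring A" and ?j = "to_total_quotient_ring A"
  let ?I = "carrier N"
  let ?V = "free_module ?Q ?I"
  interpret N: module A N by (rule N)
  interpret F: module ?Q F by (rule F)
  define g where "g y = inv_into (carrier F) f y" for y
  have g: "g y \<in> carrier F" "f (g y) = y" if "y \<in> carrier N" for y
    using that surj by (auto simp: g_def inv_into_into f_inv_into_f)
  have f_closed: "f x \<in> carrier N" if "x \<in> carrier F" for x
    using that surj by auto
  have f_add: "f (x \<oplus>\<^bsub>F\<^esub> y) = f x \<oplus>\<^bsub>N\<^esub> f y" if "x \<in> carrier F" "y \<in> carrier F" for x y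
    using f that by (simp add: module_hom_def restrict_scalars_def)
  have f_smult: "f (?j a \<odot>\<^bsub>F\<^esub> x) = a \<odot>\<^bsub>N\<^esub> f x" if "a \<in> carrier A" "x \<in> carrier F" for a x
    using f that by (simp add: module_hom_def restrict_scalars_def)
  define supp where "supp v = {i \<in> ?I. v i \<noteq> \<zero>\<^bsub>?Q\<^esub>}" for v
  define L where "L v = (\<Oplus>\<^bsub>F\<^esub>i\<in>supp v. v i \<odot>\<^bsub>F\<^esub> g i)" for v
  have V: "v i \<in> carrier ?Q" "finite (supp v)" if "v \<in> carrier ?V" "i \<in> ?I" for v i
    using that by (auto simp: free_module_def supp_def)
  have supp_sub: "supp v \<subseteq> ?I" for v
    by (auto simp: supp_def)
  have L_eq: "L v = (\<Oplus>\<^bsub>F\<^esub>i\<in>S. v i \<odot>\<^bsub>F\<^esub> g i)"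
    if "v \<in> carrier ?V" "finite S" "supp v \<subseteq> S" "S \<subseteq> ?I" for v S
    unfolding L_def using that V g
    by (intro F.add.finprod_mono_neutral_cong_left) (auto simp: supp_def subset_iff)
  have fin: "finite (supp v)" if "v \<in> carrier ?V" for v
    using that by (auto simp: free_module_def supp_def)
  have L_closed: "L v \<in> carrier F" if "v \<in> carrier ?V" for v
    unfolding L_def using that V g supp_sub by (intro F.M.finsum_closed) (auto simp: supp_def)
  interpret V: module ?Q ?V
    by (rule module_free_module[OF F.R.cring_axioms])
  have L_add: "L (v \<oplus>\<^bsub>?V\<^esub> w) = L v \<oplus>\<^bsub>F\<^esub> L w" if v: "v \<in> carrier ?V" and w: "w \<in> carrier ?V" for v w
  proof -
    let ?S = "supp v \<union> supp w"
    have S: "finite ?S" "?S \<subseteq> ?I" using fin v w supp_sub by auto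
    have eq: "(v \<oplus>\<^bsub>?V\<^esub> w) i = v i \<oplus>\<^bsub>?Q\<^esub> w i" if "i \<in> ?I" for i
      using that by (simp add: free_module_def)
    have "L (v \<oplus>\<^bsub>?V\<^esub> w) = (\<Oplus>\<^bsub>F\<^esub>i\<in>?S. (v \<oplus>\<^bsub>?V\<^esub> w) i \<odot>\<^bsub>F\<^esub> g i)"
      using S v w by (intro L_eq V.M.a_closed) (auto simp: supp_def eq)
    also have "\<dots> = (\<Oplus>\<^bsub>F\<^esub>i\<in>?S. v i \<odot>\<^bsub>F\<^esub> g i \<oplus>\<^bsub>F\<^esub> w i \<odot>\<^bsub>F\<^esub> g i)"
      using S v w V g by (intro F.M.finsum_cong') (auto simp: subset_iff eq F.smult_l_distr)
    also have "\<dots> = L v \<oplus>\<^bsub>F\<^esub> L w"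
      using S v w V g by (subst F.M.finsum_addf) (auto simp: subset_iff L_eq[of _ ?S])
    finally show ?thesis .
  qed
  have L_smult: "L (q \<odot>\<^bsub>?V\<^esub> v) = q \<odot>\<^bsub>F\<^esub> L v" if q: "q \<in> carrier ?Q" and v: "v \<in> carrier ?V" for q v
  proof -
    let ?S = "supp v"
    have S: "finite ?S" "?S \<subseteq> ?I" using fin v supp_sub by auto
    have eq: "(q \<odot>\<^bsub>?V\<^esub> v) i = q \<otimes>\<^bsub>?Q\<^esub> v i" if "i \<in> ?I" for i
      using that by (simp add: free_module_def)
    have "L (q \<odot>\<^bsub>?V\<^esub> v) = (\<Oplus>\<^bsub>F\<^esub>i\<in>?S. (q \<odot>\<^bsub>?V\<^esub> v) i \<odot>\<^bsub>F\<^esub> g i)"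
      using S v q by (intro L_eq V.smult_closed) (auto simp: supp_def eq)
    also have "\<dots> = (\<Oplus>\<^bsub>F\<^esub>i\<in>?S. q \<odot>\<^bsub>F\<^esub> (v i \<odot>\<^bsub>F\<^esub> g i))"
      using S v q V g by (intro F.M.finsum_cong') (auto simp: subset_iff eq F.smult_assoc1)
    also have "\<dots> = q \<odot>\<^bsub>F\<^esub> L v"
      unfolding L_def using S v q V g by (subst F.finsum_smult_ldistr) (auto simp: subset_iff)
    finally show ?thesis .
  qed
  have "(\<lambda>v. f (L v)) \<in> module_hom A (restrict_scalars ?j ?V) N"
    by (auto simp: module_hom_def restrict_scalars_def L_closed f_closed L_add f_add L_smult f_smult
        to_total_quotient_ring_closed[OF A])
  moreover have "(\<lambda>v. f (L v)) ` carrier ?V = carrier N"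
  proof (intro equalityI subsetI)
    fix y assume y: "y \<in> carrier N"
    define e where "e = (\<lambda>i\<in>?I. if i = y then \<one>\<^bsub>?Q\<^esub> else \<zero>\<^bsub>?Q\<^esub>)"
    have "e \<in> carrier ?V"
      by (auto simp: free_module_def e_def intro: finite_subset[of _ "{y}"])
    moreover from this have "L e = (\<Oplus>\<^bsub>F\<^esub>i\<in>{y}. e i \<odot>\<^bsub>F\<^esub> g i)"
      using y by (intro L_eq) (auto simp: supp_def e_def split: if_splits)
    then have "L e = g y"
      using y g by (simp add: e_def)
    ultimately show "y \<in> (\<lambda>v. f (L v)) ` carrier ?V"
      using y g by (auto intro!: image_eqI[of _ _ e])
  qed (auto simp: L_closed f_closed)
  ultimately show ?thesis
    unfolding h_divisible_def by blast
qed

end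

theory Submission
  imports Defs
begin

text \<open>
  Everything rests on comparing the non-zerodivisors of \<open>W\<inverse>R\<close> with those of \<open>R\<close>
  (\<open>nonzerodivisor_lift\<close>): if \<open>a/s\<close> is a non-zerodivisor of \<open>W\<inverse>R\<close>, then some non-zerodivisor
  \<open>b\<close> of \<open>R\<close> becomes a multiple of \<open>a\<close> in \<open>W\<inverse>R\<close>. To find \<open>b\<close>, let \<open>J\<close> be the preimage in \<open>R\<close>
  of the ideal of \<open>W\<inverse>R\<close> generated by \<open>a/1\<close>. Suppose that \<open>J\<close> lies in an associated prime
  \<open>P = ann(x)\<close>. From \<open>a \<in> P\<close> follows \<open>a x = 0\<close>, so \<open>x\<close> vanishes in \<open>W\<inverse>R\<close>, and therefore \<open>W\<close>
  meets \<open>P\<close>. As there are no embedded primes, \<open>P\<close> is minimal, so every element of \<open>P\<close>, in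
  particular one of \<open>W \<inter> P\<close>, is nilpotent in the localization at \<open>P\<close>. Hence an element of \<open>W\<close>
  kills some \<open>t \<notin> P\<close>. But such a \<open>t\<close> vanishes in \<open>W\<inverse>R\<close> and so belongs to \<open>J \<subseteq> P\<close>, a
  contradiction. The associated primes, being minimal, are finite in number, so by prime avoidance
  \<open>J\<close> contains an element \<open>b\<close> outside all of them, that is, a non-zerodivisor.

  It follows that multiplication by \<open>a/s\<close> on \<open>W\<inverse>M\<close> is surjective if \<open>M\<close> is divisible, and injective
  if \<open>M\<close> is torsion-free: \<open>b\<close> acts surjectively, respectively injectively, and since
  \<open>b/1 = (a/1) (c/1)\<close> for some \<open>c\<close>, its action factors through that of \<open>a\<close>. The first half is the claim about divisible modules.

  For h-divisibility, \<open>Q(A)\<close>-modules are the same thing as \<open>A\<close>-modules that are both divisible and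
  torsion-free, since for such a module \<open>F\<close> the map from \<open>F\<close> to its localization at the
  non-zerodivisors of \<open>A\<close> is bijective. So \<open>N\<close> is h-divisible if and only if it is a quotient of a
  divisible torsion-free module (\<open>h_divisibleE\<close>, \<open>h_divisible_if_quotient\<close>). In this form the
  property passes from \<open>M\<close> to \<open>W\<inverse>M\<close>: a surjection \<open>F \<rightarrow> M\<close> localizes to a surjection
  \<open>W\<inverse>F \<rightarrow> W\<inverse>M\<close>, and \<open>W\<inverse>F\<close> is again divisible and torsion-free.
\<close>

section \<open>Finiteness of the minimal primes\<close>

lemma (in noetherian_ring) maximal_in_family:
  assumes "S \<noteq> {}" "\<And>I. I \<in> S \<Longrightarrow> ideal I R"
  shows "\<exists>J\<in>S. \<forall>K\<in>S. \<not> J \<subset> K"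
proof -
  have "\<exists>J\<in>S. \<forall>K\<in>S. J \<subseteq> K \<longrightarrow> K = J"
  proof (rule subset_Zorn)
    fix C assume C: "subset.chain S C"
    show "\<exists>U\<in>S. \<forall>K\<in>C. K \<subseteq> U"
    proof (cases "C = {}")
      case False
      have "C \<subseteq> S" using C unfolding pred_on.chain_def by simp
      have "subset.chain {I. ideal I R} C"
        using C assms(2) unfolding pred_on.chain_def by blast
      then have "\<Union>C \<in> C" using False by (intro ideal_chain_is_trivial)
      then show ?thesis using \<open>C \<subseteq> S\<close> by (intro bexI[of _ "\<Union>C"]) auto
    qed (use assms(1) in auto)
  qed
  then show ?thesis by (auto simp: psubset_eq)
qed

lemma (in noetherian_ring) noetherian_induct [consumes 1, case_names step]:
  assumes "ideal I R"
    and step: "\<And>I. \<lbrakk>ideal I R; \<And>J. \<lbrakk>ideal J R; I \<subset> J\<rbrakk> \<Longrightarrow> P J\<rbrakk> \<Longrightarrow> P I"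
  shows "P I"
proof (rule ccontr)
  assume "\<not> P I"
  then have "\<exists>J\<in>{J. ideal J R \<and> \<not> P J}. \<forall>K\<in>{J. ideal J R \<and> \<not> P J}. \<not> J \<subset> K"
    using assms(1) by (intro maximal_in_family) auto
  then obtain J where J: "ideal J R" "\<not> P J" "\<forall>K. ideal K R \<and> \<not> P K \<longrightarrow> \<not> J \<subset> K" by auto
  have "P J" using J by (intro step[OF J(1)]) blast
  then show False using J(2) by contradiction
qed

context cring begin

lemma ideal_closed:
  assumes "ideal I R"
  shows "I \<subseteq> carrier R" "\<zero> \<in> I" "\<lbrakk>x \<in> I; y \<in> I\<rbrakk> \<Longrightarrow> x \<oplus> y \<in> I" "x \<in> I \<Longrightarrow> \<ominus> x \<in> I"
proof -
  interpret A: additive_subgroup I R using assms by (rule ideal.axioms(1))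
  show "I \<subseteq> carrier R" by (rule A.a_subset)
  show "\<zero> \<in> I" by (rule A.zero_closed)
  show "x \<oplus> y \<in> I" if "x \<in> I" "y \<in> I" using that by (rule A.a_closed)
  show "\<ominus> x \<in> I" if "x \<in> I" by (rule A.a_inv_closed[OF that])
qed

lemmas primeideal_subset = ideal_closed(1)[OF primeideal.axioms(1)]

lemma ideal_insert:
  assumes "ideal I R" "a \<in> carrier R" "a \<notin> I"
  shows "ideal (I <+>\<^bsub>R\<^esub> PIdl a) R" "I \<subset> I <+>\<^bsub>R\<^esub> PIdl a"
    "x \<in> I <+>\<^bsub>R\<^esub> PIdl a \<Longrightarrow> \<exists>i\<in>I. \<exists>r\<in>carrier R. x = i \<oplus> r \<otimes> a"
proof -
  interpret I: ideal I R by fact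
  show "ideal (I <+>\<^bsub>R\<^esub> PIdl a) R"
    using assms cgenideal_ideal by (intro add_ideals)
  have "\<zero> \<in> PIdl a" "a \<in> PIdl a"
    using ideal_closed(2)[OF cgenideal_ideal[OF assms(2)]] cgenideal_self[OF assms(2)] by auto
  moreover have "i \<oplus> k \<in> I <+>\<^bsub>R\<^esub> PIdl a" if "i \<in> I" "k \<in> PIdl a" for i k
    unfolding set_add_def' using that by auto
  ultimately have *: "i \<oplus> \<zero> \<in> I <+>\<^bsub>R\<^esub> PIdl a" "i \<oplus> a \<in> I <+>\<^bsub>R\<^esub> PIdl a" if "i \<in> I" for i
    using that by blast+
  have "I \<subseteq> I <+>\<^bsub>R\<^esub> PIdl a"
    using *(1) ideal_closed(1)[OF assms(1)] by fastforce
  moreover have "a \<in> I <+>\<^bsub>R\<^esub> PIdl a"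
    using *(2)[OF ideal_closed(2)[OF assms(1)]] assms(2) by simp
  ultimately show "I \<subset> I <+>\<^bsub>R\<^esub> PIdl a" using assms(3) by blast
  show "\<exists>i\<in>I. \<exists>r\<in>carrier R. x = i \<oplus> r \<otimes> a" if "x \<in> I <+>\<^bsub>R\<^esub> PIdl a"
    using that by (auto simp: set_add_def' cgenideal_def)
qed

text \<open>This is the theorem that \<open>I\<close> contains a finite product of primes, in a form that makes no mention
  of products of ideals: choosing an element of \<open>S\<close> in each factor yields an
  element of \<open>S\<close> in \<open>I\<close>. It holds by Noetherian induction: if \<open>a b \<in> I\<close> with \<open>a, b \<notin> I\<close>, then
  the primes for \<open>I + (a)\<close> and those for \<open>I + (b)\<close> together serve for \<open>I\<close>, because
  \<open>(I + (a)) (I + (b)) \<subseteq> I\<close>.\<close>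

lemma finite_primes_controlling_ideal:
  assumes "noetherian_ring R" "ideal I R"
  shows "\<exists>\<P>. finite \<P> \<and> (\<forall>P\<in>\<P>. primeideal P R) \<and>
    (\<forall>S. submonoid S R \<longrightarrow> (\<forall>P\<in>\<P>. S \<inter> P \<noteq> {}) \<longrightarrow> S \<inter> I \<noteq> {})"
  using assms(2)
proof (induction rule: noetherian_ring.noetherian_induct[OF assms(1), consumes 1, case_names step])
  case (step I)
  interpret I: ideal I R by fact
  consider "I = carrier R" | "primeideal I R"
    | a b where "a \<in> carrier R" "b \<in> carrier R" "a \<otimes> b \<in> I" "a \<notin> I" "b \<notin> I"
    using I.primeidealCD[OF cring_axioms] by blast
  then show ?case
  proof cases
    case 1
    have "S \<inter> I \<noteq> {}" if "submonoid S R" for S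
      using submonoid.one_closed[OF that] 1 by blast
    then show ?thesis by (intro exI[of _ "{}"]) simp
  next
    case 2
    then show ?thesis by (intro exI[of _ "{I}"]) simp
  next
    case (3 a b)
    note A = ideal_insert[OF step.hyps 3(1,4)] and B = ideal_insert[OF step.hyps 3(2,5)]
    obtain \<A> where \<A>: "finite \<A>" "\<forall>P\<in>\<A>. primeideal P R"
      "\<And>S. \<lbrakk>submonoid S R; \<forall>P\<in>\<A>. S \<inter> P \<noteq> {}\<rbrakk> \<Longrightarrow> S \<inter> (I <+>\<^bsub>R\<^esub> PIdl a) \<noteq> {}"
      using step.IH[OF A(1,2)] by blast
    obtain \<B> where \<B>: "finite \<B>" "\<forall>P\<in>\<B>. primeideal P R"
      "\<And>S. \<lbrakk>submonoid S R; \<forall>P\<in>\<B>. S \<inter> P \<noteq> {}\<rbrakk> \<Longrightarrow> S \<inter> (I <+>\<^bsub>R\<^esub> PIdl b) \<noteq> {}"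
      using step.IH[OF B(1,2)] by blast
    have "S \<inter> I \<noteq> {}" if S: "submonoid S R" "\<forall>P\<in>\<A> \<union> \<B>. S \<inter> P \<noteq> {}" for S
    proof -
      obtain s t where st: "s \<in> S" "s \<in> I <+>\<^bsub>R\<^esub> PIdl a" "t \<in> S" "t \<in> I <+>\<^bsub>R\<^esub> PIdl b"
        using \<A>(3) \<B>(3) S by blast
      obtain i r where i: "i \<in> I" "r \<in> carrier R" "s = i \<oplus> r \<otimes> a" using A(3) st by blast
      obtain j q where j: "j \<in> I" "q \<in> carrier R" "t = j \<oplus> q \<otimes> b" using B(3) st by blast
      have ic: "i \<in> carrier R" "j \<in> carrier R" using i j I.a_subset by auto
      have "s \<otimes> t = i \<otimes> t \<oplus> ((r \<otimes> a) \<otimes> j \<oplus> (r \<otimes> q) \<otimes> (a \<otimes> b))"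
        using i j ic 3(1,2) by (simp add: l_distr r_distr m_assoc m_lcomm a_ac)
      moreover have "i \<otimes> t \<in> I" using j(2,3) ic 3(2) by (intro I.I_r_closed[OF i(1)]) simp
      moreover have "(r \<otimes> a) \<otimes> j \<in> I" using i(2) 3(1) by (intro I.I_l_closed[OF j(1)]) simp
      moreover have "(r \<otimes> q) \<otimes> (a \<otimes> b) \<in> I" using i(2) j(2) by (intro I.I_l_closed[OF 3(3)]) simp
      ultimately have "s \<otimes> t \<in> I" by (simp add: ideal_closed(3)[OF step.hyps])
      moreover have "s \<otimes> t \<in> S" using S(1) st by (intro submonoid.m_closed)
      ultimately show ?thesis by blast
    qed
    moreover have "finite (\<A> \<union> \<B>)" using \<A>(1) \<B>(1) by simp
    moreover have "\<forall>P\<in>\<A> \<union> \<B>. primeideal P R" using \<A>(2) \<B>(2) by blast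
    ultimately show ?thesis by (intro exI[of _ "\<A> \<union> \<B>"] conjI allI impI)
  qed
qed

lemma submonoid_compl_primeideal:
  assumes "primeideal P R" shows "submonoid (carrier R - P) R"
proof -
  interpret P: primeideal P R by fact
  show ?thesis
    using P.I_prime P.one_imp_carrier P.I_notcarr
    by (intro submonoid.intro) auto
qed

text \<open>Among the finitely many primes that control \<open>{0}\<close>, one must be contained in a given prime \<open>P\<close>,
  as the complement of \<open>P\<close> does not contain \<open>0\<close>. If \<open>P\<close> is minimal, that prime is \<open>P\<close>.\<close>

lemma finite_minimal_primes:
  assumes "noetherian_ring R"
  shows "finite {P. minimal_prime R P}"
proof -
  obtain \<P> where \<P>: "finite \<P>" "\<forall>P\<in>\<P>. primeideal P R"
    "\<And>S. \<lbrakk>submonoid S R; \<forall>P\<in>\<P>. S \<inter> P \<noteq> {}\<rbrakk> \<Longrightarrow> S \<inter> {\<zero>} \<noteq> {}"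
    using finite_primes_controlling_ideal[OF assms zeroideal] by blast
  have "P \<in> \<P>" if P: "minimal_prime R P" for P
  proof -
    have prime: "primeideal P R" using P by (simp add: minimal_prime_def)
    interpret P: primeideal P R by fact
    obtain Q where Q: "Q \<in> \<P>" "(carrier R - P) \<inter> Q = {}"
      using \<P>(3)[OF submonoid_compl_primeideal[OF prime]] ideal_closed(2)[OF P.is_ideal]
      by blast
    moreover have "Q \<subseteq> carrier R" using Q(1) \<P>(2) primeideal_subset by blast
    ultimately have "Q \<subseteq> P" by blast
    then show ?thesis using P Q(1) \<P>(2) by (auto simp: minimal_prime_def)
  qed
  then show ?thesis using \<P>(1) by (auto intro: finite_subset)
qed

text \<open>The localization at a minimal prime \<open>P\<close> has \<open>P\<close> as its only prime, so the elements of \<open>P\<close> are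
  nilpotent there. Here this is expressed in \<open>R\<close> itself: a prime disjoint from the
  monoid generated by \<open>W\<close> and the complement of \<open>P\<close> would lie in \<open>P\<close>, hence equal \<open>P\<close>, but \<open>W\<close>
  meets \<open>P\<close>. So there is no such prime, and the monoid contains \<open>0\<close>.\<close>

lemma minimal_prime_meets_submonoid:
  assumes "noetherian_ring R" "minimal_prime R P" "submonoid W R" "W \<inter> P \<noteq> {}"
  shows "\<exists>w\<in>W. \<exists>t\<in>carrier R - P. w \<otimes> t = \<zero>"
proof -
  have prime: "primeideal P R" using assms(2) by (simp add: minimal_prime_def)
  interpret P: primeideal P R by fact
  interpret W: submonoid W R by fact
  interpret S: submonoid "carrier R - P" R by (rule submonoid_compl_primeideal[OF prime])
  define T where "T = {w \<otimes> t | w t. w \<in> W \<and> t \<in> carrier R - P}"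
  have Wc: "w \<in> carrier R" if "w \<in> W" for w using that W.subset by blast
  have TI: "w \<otimes> t \<in> T" if "w \<in> W" "t \<in> carrier R - P" for w t
    using that unfolding T_def by blast
  have WT: "W \<subseteq> T" "carrier R - P \<subseteq> T"
    using TI[OF _ S.one_closed] TI[OF W.one_closed] Wc by auto
  have T: "submonoid T R"
  proof (rule submonoid.intro)
    show "T \<subseteq> carrier R" using Wc by (auto simp: T_def)
    show "\<one> \<in> T" using WT W.one_closed by blast
    fix x y assume "x \<in> T" "y \<in> T"
    then obtain v s w t where v: "v \<in> W" "s \<in> carrier R - P" "x = v \<otimes> s"
      and w: "w \<in> W" "t \<in> carrier R - P" "y = w \<otimes> t" by (auto simp: T_def)
    have "x \<otimes> y = (v \<otimes> w) \<otimes> (s \<otimes> t)"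
      using v w Wc by (simp add: m_assoc m_lcomm)
    moreover have "v \<otimes> w \<in> W" "s \<otimes> t \<in> carrier R - P"
      using v w W.m_closed S.m_closed by auto
    ultimately show "x \<otimes> y \<in> T" by (simp only: TI)
  qed
  obtain \<P> where \<P>: "\<forall>P\<in>\<P>. primeideal P R"
    "\<And>S. \<lbrakk>submonoid S R; \<forall>P\<in>\<P>. S \<inter> P \<noteq> {}\<rbrakk> \<Longrightarrow> S \<inter> {\<zero>} \<noteq> {}"
    using finite_primes_controlling_ideal[OF assms(1) zeroideal] by blast
  have "T \<inter> Q \<noteq> {}" if Q: "Q \<in> \<P>" for Q
  proof
    assume disj: "T \<inter> Q = {}"
    have "Q \<subseteq> carrier R" using Q \<P>(1) primeideal_subset by blast
    then have "Q \<subseteq> P" using disj WT(2) by blast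
    then have "Q = P" using assms(2) Q \<P>(1) by (auto simp: minimal_prime_def)
    then show False using disj WT(1) assms(4) by blast
  qed
  then have "\<zero> \<in> T" using \<P>(2)[OF T] by blast
  then obtain w t where "w \<in> W" "t \<in> carrier R - P" "\<zero> = w \<otimes> t" unfolding T_def by blast
  then show ?thesis by metis
qed

end

section \<open>Zerodivisors and prime avoidance\<close>

context cring begin

lemma ideal_annihilator:
  assumes "x \<in> carrier R" shows "ideal (annihilator R x) R"
proof (rule idealI[OF ring_axioms])
  show "subgroup (annihilator R x) (add_monoid R)"
    using assms
    by (intro subgroup.intro) (auto simp: annihilator_def l_distr l_minus simp flip: a_inv_def)
  fix a r assume a: "a \<in> annihilator R x" and r: "r \<in> carrier R"
  show "r \<otimes> a \<in> annihilator R x"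
    using assms a r by (simp add: annihilator_def m_assoc)
  then show "a \<otimes> r \<in> annihilator R x"
    using a r by (simp add: annihilator_def m_comm)
qed

text \<open>An annihilator that is maximal among the annihilators of nonzero elements is prime, and by
  Noetherianity every such annihilator is contained in a maximal one.\<close>

lemma zerodivisor_in_associated_prime:
  assumes "noetherian_ring R" "b \<in> carrier R" "b \<notin> nonzerodivisors R"
  obtains P where "associated_prime R P" "b \<in> P"
proof -
  obtain x where x: "x \<in> carrier R" "b \<otimes> x = \<zero>" "x \<noteq> \<zero>"
    using assms(2,3) by (auto simp: nonzerodivisors_def)
  let ?S = "{annihilator R y | y. y \<in> carrier R \<and> y \<noteq> \<zero> \<and> annihilator R x \<subseteq> annihilator R y}"
  have "annihilator R x \<in> ?S" using x by auto
  moreover have "ideal I R" if "I \<in> ?S" for I using that ideal_annihilator by auto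
  ultimately obtain P where P: "P \<in> ?S" and max: "\<forall>K\<in>?S. \<not> P \<subset> K"
    using noetherian_ring.maximal_in_family[OF assms(1), of ?S] by blast
  from P obtain y where y: "y \<in> carrier R" "y \<noteq> \<zero>" "annihilator R x \<subseteq> annihilator R y"
    and P_eq: "P = annihilator R y" by blast
  have "primeideal P R"
  proof (rule primeidealI[OF _ cring_axioms])
    show "ideal P R" unfolding P_eq by (rule ideal_annihilator[OF y(1)])
    show "carrier R \<noteq> P"
      using y(1,2) by (auto simp: P_eq annihilator_def set_eq_iff intro!: exI[of _ \<one>])
    fix c d assume cd: "c \<in> carrier R" "d \<in> carrier R" "c \<otimes> d \<in> P"
    show "c \<in> P \<or> d \<in> P"
    proof (cases "d \<in> P")
      case False
      have sub: "annihilator R y \<subseteq> annihilator R (d \<otimes> y)"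
        using cd(2) y(1) by (auto simp: annihilator_def m_lcomm[of _ d])
      have "d \<otimes> y \<noteq> \<zero>" using False cd(2) by (simp add: P_eq annihilator_def)
      then have "annihilator R (d \<otimes> y) \<in> ?S" using cd(2) y sub by auto
      then have "annihilator R (d \<otimes> y) = P" using max sub P_eq by blast
      moreover have "c \<in> annihilator R (d \<otimes> y)"
        using cd y(1) by (simp add: P_eq annihilator_def m_assoc)
      ultimately show ?thesis by simp
    qed simp
  qed
  then show thesis
    using that[of P] assms(2) x y P_eq by (auto simp: associated_prime_def annihilator_def)
qed

lemma primeideal_avoids_intersection:
  assumes "primeideal P R" "finite \<I>"
    and "\<And>I. I \<in> \<I> \<Longrightarrow> ideal I R" "\<And>I. I \<in> \<I> \<Longrightarrow> \<not> I \<subseteq> P"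
  shows "\<exists>y\<in>carrier R - P. \<forall>I\<in>\<I>. y \<in> I"
  using assms(2-)
proof (induction rule: finite_induct)
  case empty
  show ?case using submonoid.one_closed[OF submonoid_compl_primeideal[OF assms(1)]] by blast
next
  case (insert I \<I>)
  then obtain y where y: "y \<in> carrier R - P" "\<forall>I\<in>\<I>. y \<in> I" by auto
  interpret I: ideal I R using insert.prems by simp
  obtain z where z: "z \<in> I" "z \<notin> P" using insert.prems by blast
  have "y \<otimes> z \<in> carrier R - P"
    using y z I.a_subset submonoid.m_closed[OF submonoid_compl_primeideal[OF assms(1)]] by blast
  moreover have "y \<otimes> z \<in> I" using y z by (intro I.I_l_closed) auto
  moreover have "y \<otimes> z \<in> K" if "K \<in> \<I>" for K
    using y z I.a_subset that insert.prems by (intro ideal.I_r_closed) auto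
  ultimately show ?case by (intro bexI[of _ "y \<otimes> z"]) auto
qed

text \<open>Avoiding a prime also avoids every smaller one, so if some \<open>P\<close> contains another member of the
  family, that member can be discarded. Otherwise take \<open>x \<in> J\<close> outside all primes but \<open>P\<close>; if it
  happens to lie in \<open>P\<close>, correct it by an element of \<open>J\<close> that lies in all the other primes but
  not in \<open>P\<close>.\<close>

lemma prime_avoidance:
  assumes "ideal J R" "finite \<P>"
    and "\<And>P. P \<in> \<P> \<Longrightarrow> primeideal P R" "\<And>P. P \<in> \<P> \<Longrightarrow> \<not> J \<subseteq> P"
  shows "\<exists>x\<in>J. \<forall>P\<in>\<P>. x \<notin> P"
  using assms(2-)
proof (induction rule: finite_psubset_induct)
  case (psubset \<P>)
  interpret J: ideal J R by fact
  consider "\<P> = {}" | P Q where "P \<in> \<P>" "Q \<in> \<P>" "P \<noteq> Q" "Q \<subseteq> P"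
    | P where "P \<in> \<P>" "\<forall>Q\<in>\<P>. P \<noteq> Q \<longrightarrow> \<not> Q \<subseteq> P"
    by (metis all_not_in_conv)
  then show ?case
  proof cases
    case 1
    then show ?thesis using ideal_closed(2)[OF assms(1)] by blast
  next
    case (2 P Q)
    have "\<P> - {Q} \<subset> \<P>" using 2 by blast
    from psubset.IH[OF this] psubset.prems obtain x where "x \<in> J" "\<forall>P\<in>\<P> - {Q}. x \<notin> P"
      by blast
    then show ?thesis using 2 by blast
  next
    case (3 P)
    have "\<P> - {P} \<subset> \<P>" using 3 by blast
    from psubset.IH[OF this] psubset.prems obtain x where x: "x \<in> J" "\<forall>Q\<in>\<P> - {P}. x \<notin> Q"
      by blast
    show ?thesis
    proof (cases "x \<in> P")
      case False
      then show ?thesis using x by blast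
    next
      case True
      have prime: "primeideal P R" using 3 psubset.prems by blast
      interpret P: primeideal P R by fact
      have "\<exists>y\<in>carrier R - P. \<forall>I\<in>insert J (\<P> - {P}). y \<in> I"
      proof (rule primeideal_avoids_intersection[OF prime])
        show "ideal I R" if "I \<in> insert J (\<P> - {P})" for I
          using that assms(1) psubset.prems primeideal.axioms(1) by blast
        show "\<not> I \<subseteq> P" if "I \<in> insert J (\<P> - {P})" for I
          using that 3 psubset.prems by blast
      qed (use psubset.hyps in auto)
      then obtain y where y: "y \<in> carrier R" "y \<notin> P" "y \<in> J" "\<forall>Q\<in>\<P> - {P}. y \<in> Q" by auto
      have xc: "x \<in> carrier R" using x J.a_subset by blast
      have "x \<oplus> y \<notin> Q" if Q: "Q \<in> \<P>" for Q
      proof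
        assume sum: "x \<oplus> y \<in> Q"
        interpret Q: primeideal Q R using Q psubset.prems by blast
        have "y = (x \<oplus> y) \<oplus> \<ominus> x" "x = (x \<oplus> y) \<oplus> \<ominus> y" using xc y(1) by algebra+
        then show False
          using sum True x y Q by (metis DiffI ideal_closed(3,4) Q.is_ideal singletonD)
      qed
      then show ?thesis using x y ideal_closed(3)[OF assms(1)] by blast
    qed
  qed
qed

end

section \<open>Non-zerodivisors of a localization\<close>

context cring begin

text \<open>The hypothesis on \<open>a\<close> says that \<open>a/1\<close> is a non-zerodivisor of \<open>W\<inverse>R\<close>, and the conclusion that
  the non-zerodivisor \<open>b\<close> satisfies \<open>b/1 = (a/1) (c/1)\<close>. Both are phrased in \<open>R\<close>, with the
  denominators cleared.\<close>

lemma nonzerodivisor_lift: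
  assumes noeth: "noetherian_ring R" and noemb: "no_embedded_primes R" and W: "submonoid W R"
    and a: "a \<in> carrier R"
    and reg: "\<And>x w. \<lbrakk>x \<in> carrier R; w \<in> W; w \<otimes> (a \<otimes> x) = \<zero>\<rbrakk> \<Longrightarrow> \<exists>v\<in>W. v \<otimes> x = \<zero>"
  obtains b c w where "b \<in> nonzerodivisors R" "c \<in> carrier R" "w \<in> W" "w \<otimes> b = w \<otimes> (a \<otimes> c)"
proof -
  interpret W: submonoid W R by fact
  have Wc: "w \<in> carrier R" if "w \<in> W" for w using that W.subset by blast
  \<comment> \<open>the preimage in \<open>R\<close> of the ideal of \<open>W\<inverse>R\<close> generated by \<open>a/1\<close>\<close>
  define J where "J = {r \<in> carrier R. \<exists>c\<in>carrier R. \<exists>w\<in>W. w \<otimes> r = w \<otimes> (a \<otimes> c)}"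
  have JI: "r \<in> J" if "r \<in> carrier R" "c \<in> carrier R" "w \<in> W" "w \<otimes> r = w \<otimes> (a \<otimes> c)" for r c w
    using that by (auto simp: J_def)
  have J: "ideal J R"
  proof (rule idealI[OF ring_axioms subgroup.intro])
    show "J \<subseteq> carrier (add_monoid R)" by (auto simp: J_def)
    show "\<one>\<^bsub>add_monoid R\<^esub> \<in> J"
      using a W.one_closed by (auto intro!: JI[of \<zero> \<zero> \<one>])
    fix x assume "x \<in> J"
    then obtain c w where x: "x \<in> carrier R" "c \<in> carrier R" "w \<in> W" "w \<otimes> x = w \<otimes> (a \<otimes> c)"
      by (auto simp: J_def)
    show "inv\<^bsub>add_monoid R\<^esub> x \<in> J"
      using x a Wc
      by (auto simp flip: a_inv_def simp: r_minus intro!: JI[of _ "\<ominus> c" w])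
    show "r \<otimes> x \<in> J" if "r \<in> carrier R" for r
      using x a Wc that
      by (intro JI[of _ "r \<otimes> c" w]) (simp_all add: m_lcomm)
    then show "x \<otimes> r \<in> J" if "r \<in> carrier R" for r
      using that x by (simp add: m_comm)
    fix y assume "y \<in> J"
    then obtain d v where y: "y \<in> carrier R" "d \<in> carrier R" "v \<in> W" "v \<otimes> y = v \<otimes> (a \<otimes> d)"
      by (auto simp: J_def)
    have "(w \<otimes> v) \<otimes> (x \<oplus> y) = v \<otimes> (w \<otimes> x) \<oplus> w \<otimes> (v \<otimes> y)"
      using x(1-3) y(1-3) Wc by (simp add: r_distr m_assoc m_lcomm)
    also have "\<dots> = (w \<otimes> v) \<otimes> (a \<otimes> (c \<oplus> d))"
      unfolding x(4) y(4) using x(1-3) y(1-3) a Wc by (simp add: r_distr m_assoc m_lcomm)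
    finally have "x \<oplus> y \<in> J"
      using x(1-3) y(1-3) by (intro JI[of _ "c \<oplus> d" "w \<otimes> v"]) simp_all
    then show "x \<otimes>\<^bsub>add_monoid R\<^esub> y \<in> J" by simp
  qed
  have aJ: "a \<in> J" using a W.one_closed by (intro JI[of _ \<one> \<one>]) auto
  have "\<not> J \<subseteq> P" if P: "associated_prime R P" for P
  proof
    assume JP: "J \<subseteq> P"
    obtain x where x: "x \<in> carrier R" "P = annihilator R x"
      using P by (auto simp: associated_prime_def)
    have "a \<otimes> x = \<zero>" using aJ JP x by (auto simp: annihilator_def)
    then obtain v where "v \<in> W" "v \<otimes> x = \<zero>"
      using reg[OF x(1) W.one_closed] a x(1) by auto
    then have "W \<inter> P \<noteq> {}" using x Wc by (auto simp: annihilator_def)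
    then obtain w t where "w \<in> W" "t \<in> carrier R - P" "w \<otimes> t = \<zero>"
      using minimal_prime_meets_submonoid[OF noeth _ W] noemb P
      unfolding no_embedded_primes_def by metis
    \<comment> \<open>\<open>t\<close> vanishes in \<open>W\<inverse>R\<close>, so \<open>c = 0\<close> will do\<close>
    moreover from this have "t \<in> J" using a Wc by (intro JI[of _ \<zero> w]) auto
    ultimately show False using JP by blast
  qed
  moreover have "finite {P. associated_prime R P}"
    by (rule finite_subset[OF _ finite_minimal_primes[OF noeth]])
      (use noemb in \<open>simp add: no_embedded_primes_def subset_iff\<close>)
  ultimately have "\<exists>b\<in>J. \<forall>P\<in>{P. associated_prime R P}. b \<notin> P"
    by (intro prime_avoidance[OF J]) (simp_all add: associated_prime_def)
  then obtain b where b: "b \<in> J" "\<forall>P. associated_prime R P \<longrightarrow> b \<notin> P" by auto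
  from b(1) obtain c w where cw: "b \<in> carrier R" "c \<in> carrier R" "w \<in> W" "w \<otimes> b = w \<otimes> (a \<otimes> c)"
    unfolding J_def by blast
  have "b \<in> nonzerodivisors R"
  proof (rule ccontr)
    assume "b \<notin> nonzerodivisors R"
    with noeth cw(1) obtain P where "associated_prime R P" "b \<in> P"
      by (rule zerodivisor_in_associated_prime)
    then show False using b(2) by blast
  qed
  then show thesis using cw(2-4) by (rule that)
qed

end

context module_fractions
begin

lemma smult_regular [simp]: "a \<odot>\<^bsub>regular_module R\<^esub> b = a \<otimes> b"
  by (simp add: regular_module_def)

lemma zero_regular [simp]: "\<zero>\<^bsub>regular_module R\<^esub> = \<zero>"
  by (simp add: regular_module_def)

lemma nonzerodivisor_localize_ring_iff:
  assumes "a \<in> carrier R" "s \<in> W"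
  shows "fraction W R (regular_module R) a s \<in> nonzerodivisors (localize_ring W R) \<longleftrightarrow>
    (\<forall>x\<in>carrier R. \<forall>w\<in>W. w \<otimes> (a \<otimes> x) = \<zero> \<longrightarrow> (\<exists>v\<in>W. v \<otimes> x = \<zero>))"
proof -
  interpret S: module_fractions R "regular_module R" W by (rule regular)
  let ?f = "fraction W R (regular_module R)" and ?L = "localize_ring W R"
  have zero_iff: "?f x t = \<zero>\<^bsub>?L\<^esub> \<longleftrightarrow> (\<exists>u\<in>W. u \<otimes> x = \<zero>)" if "x \<in> carrier R" "t \<in> W" for x t
    using that by (simp add: localize_ring_def S.zero_localize S.fraction_eq_iff)
  have mult: "?f a s \<otimes>\<^bsub>?L\<^esub> ?f x t = ?f (a \<otimes> x) (s \<otimes> t)" if "x \<in> carrier R" "t \<in> W" for x t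
    using that assms by (simp add: localize_ring_def S.fraction_smult)
  have closed: "?f x t \<in> carrier ?L" if "x \<in> carrier R" "t \<in> W" for x t
    using that by (simp add: localize_ring_def)
  have cases: "\<exists>x\<in>carrier R. \<exists>t\<in>W. p = ?f x t" if "p \<in> carrier ?L" for p
  proof -
    have "p \<in> carrier (localize_module W R (regular_module R))"
      using that by (simp add: localize_ring_def)
    then obtain x t where "x \<in> carrier (regular_module R)" "t \<in> W" "p = ?f x t"
      by (rule S.fraction_cases)
    then show ?thesis unfolding carrier_regular by blast
  qed
  show ?thesis
  proof
    assume nzd: "?f a s \<in> nonzerodivisors ?L"
    show "\<forall>x\<in>carrier R. \<forall>w\<in>W. w \<otimes> (a \<otimes> x) = \<zero> \<longrightarrow> (\<exists>v\<in>W. v \<otimes> x = \<zero>)"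
    proof (intro ballI impI)
      fix x w assume x: "x \<in> carrier R" "w \<in> W" "w \<otimes> (a \<otimes> x) = \<zero>"
      have "?f a s \<otimes>\<^bsub>?L\<^esub> ?f x \<one> = \<zero>\<^bsub>?L\<^esub>"
        using x assms by (subst mult) (auto simp: zero_iff)
      then have "?f x \<one> = \<zero>\<^bsub>?L\<^esub>"
        using nzd closed[OF x(1) one_closed] by (auto simp: nonzerodivisors_def)
      then show "\<exists>v\<in>W. v \<otimes> x = \<zero>" using x(1) by (simp add: zero_iff)
    qed
  next
    assume reg: "\<forall>x\<in>carrier R. \<forall>w\<in>W. w \<otimes> (a \<otimes> x) = \<zero> \<longrightarrow> (\<exists>v\<in>W. v \<otimes> x = \<zero>)"
    have "p = \<zero>\<^bsub>?L\<^esub>" if p: "p \<in> carrier ?L" "?f a s \<otimes>\<^bsub>?L\<^esub> p = \<zero>\<^bsub>?L\<^esub>" for p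
    proof -
      obtain x t where x: "x \<in> carrier R" "t \<in> W" "p = ?f x t" using cases[OF p(1)] by blast
      then show ?thesis using p(2) reg assms by (auto simp: mult zero_iff)
    qed
    then show "?f a s \<in> nonzerodivisors ?L"
      using closed[OF assms] by (auto simp: nonzerodivisors_def)
  qed
qed

end

section \<open>Divisible and torsion-free modules under localization\<close>

definition torsion_free :: "('a, 'm) ring_scheme \<Rightarrow> ('a, 'b, 'n) module_scheme \<Rightarrow> bool" where
  "torsion_free A N \<longleftrightarrow> (\<forall>a\<in>nonzerodivisors A. inj_on (\<lambda>x. a \<odot>\<^bsub>N\<^esub> x) (carrier N))"

context module_fractions
begin

lemma nonzerodivisor_localize_ringE:
  assumes "noetherian_ring R" "no_embedded_primes R" "p \<in> nonzerodivisors (localize_ring W R)"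
  obtains a s b c w where "a \<in> carrier R" "s \<in> W" "p = fraction W R (regular_module R) a s"
    "b \<in> nonzerodivisors R" "c \<in> carrier R" "w \<in> W" "w \<otimes> b = w \<otimes> (a \<otimes> c)"
proof -
  have "p \<in> carrier (localize_module W R (regular_module R))"
    using assms(3) by (simp add: nonzerodivisors_def localize_ring_def)
  then obtain a s where a: "a \<in> carrier R" "s \<in> W" "p = fraction W R (regular_module R) a s"
    by (rule module_fractions.fraction_cases[OF regular]) simp
  have reg: "\<exists>v\<in>W. v \<otimes> x = \<zero>" if "x \<in> carrier R" "w \<in> W" "w \<otimes> (a \<otimes> x) = \<zero>" for x w
    using assms(3) that unfolding a(3) nonzerodivisor_localize_ring_iff[OF a(1,2)] by blast
  obtain b c w where "b \<in> nonzerodivisors R" "c \<in> carrier R" "w \<in> W" "w \<otimes> b = w \<otimes> (a \<otimes> c)"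
    by (rule R.nonzerodivisor_lift[OF assms(1,2) submonoid_axioms a(1)]) (rule reg)
  then show thesis by (rule that[OF a])
qed

text \<open>Given \<open>y/t\<close> and \<open>p = a/s\<close>, write \<open>y = b x\<close>. Since \<open>b = a c\<close> in \<open>W\<inverse>R\<close>, the fraction
  \<open>(s c x)/t\<close> is mapped to \<open>(a c x)/t = y/t\<close>.\<close>

lemma divisible_localize_module:
  assumes "noetherian_ring R" "no_embedded_primes R" "divisible R M"
  shows "divisible (localize_ring W R) (localize_module W R M)"
  unfolding divisible_def
proof (intro ballI)
  let ?L = "localize_module W R M"
  fix p assume p: "p \<in> nonzerodivisors (localize_ring W R)"
  then obtain a s b c w where a: "a \<in> carrier R" "s \<in> W" "p = fraction W R (regular_module R) a s"
    and b: "b \<in> nonzerodivisors R" "c \<in> carrier R" "w \<in> W" "w \<otimes> b = w \<otimes> (a \<otimes> c)"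
    by (rule nonzerodivisor_localize_ringE[OF assms(1,2)])
  have bc: "b \<in> carrier R" using b by (simp add: nonzerodivisors_def)
  show "(\<lambda>q. p \<odot>\<^bsub>?L\<^esub> q) ` carrier ?L = carrier ?L"
  proof (intro equalityI subsetI)
    fix q assume "q \<in> (\<lambda>q. p \<odot>\<^bsub>?L\<^esub> q) ` carrier ?L"
    then obtain r where r: "r \<in> carrier ?L" "q = p \<odot>\<^bsub>?L\<^esub> r" by blast
    then obtain x t where "x \<in> carrier M" "t \<in> W" "r = fraction W R M x t" by (elim fraction_cases)
    then show "q \<in> carrier ?L" using a r(2) by (simp add: fraction_smult)
  next
    fix q assume "q \<in> carrier ?L"
    then obtain y t where y: "y \<in> carrier M" "t \<in> W" "q = fraction W R M y t" by (rule fraction_cases)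
    have "y \<in> (\<lambda>x. b \<odot>\<^bsub>M\<^esub> x) ` carrier M"
      using assms(3) b(1) y(1) by (simp add: divisible_def)
    then obtain x where x: "x \<in> carrier M" "y = b \<odot>\<^bsub>M\<^esub> x" by blast
    let ?z = "s \<odot>\<^bsub>M\<^esub> (c \<odot>\<^bsub>M\<^esub> x)"
    have "w \<odot>\<^bsub>M\<^esub> (t \<odot>\<^bsub>M\<^esub> (a \<odot>\<^bsub>M\<^esub> ?z)) = s \<odot>\<^bsub>M\<^esub> (t \<odot>\<^bsub>M\<^esub> ((w \<otimes> (a \<otimes> c)) \<odot>\<^bsub>M\<^esub> x))"
      using a b(2,3) x y(2) by (simp add: smult_assoc1 smult_left_commute)
    also have "\<dots> = w \<odot>\<^bsub>M\<^esub> ((s \<otimes> t) \<odot>\<^bsub>M\<^esub> y)"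
      unfolding b(4)[symmetric] using a bc b(3) x y(2) by (simp add: smult_assoc1 smult_left_commute)
    finally have eq: "w \<odot>\<^bsub>M\<^esub> (t \<odot>\<^bsub>M\<^esub> (a \<odot>\<^bsub>M\<^esub> ?z)) = w \<odot>\<^bsub>M\<^esub> ((s \<otimes> t) \<odot>\<^bsub>M\<^esub> y)" .
    have z: "?z \<in> carrier M" using a(2) b(2) x(1) by simp
    have "p \<odot>\<^bsub>?L\<^esub> fraction W R M ?z t = fraction W R M (a \<odot>\<^bsub>M\<^esub> ?z) (s \<otimes> t)"
      unfolding a(3) using a(1,2) z y(2) by (simp only: fraction_smult)
    also have "\<dots> = fraction W R M y t"
      using a(1,2) z y(1,2) b(3) eq by (subst fraction_eq_iff) auto
    finally show "q \<in> (\<lambda>q. p \<odot>\<^bsub>?L\<^esub> q) ` carrier ?L"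
      unfolding y(3) using z y(2) by (metis fraction_carrier image_eqI)
  qed
qed

text \<open>Multiply an equation \<open>p q = p q'\<close>, with \<open>p = a/s\<close> and denominators cleared by \<open>u\<close>, by
  \<open>w c\<close>. This turns \<open>a\<close> into the non-zerodivisor \<open>b\<close>, which can be cancelled in \<open>M\<close>.\<close>

lemma torsion_free_localize_module:
  assumes "noetherian_ring R" "no_embedded_primes R" "torsion_free R M"
  shows "torsion_free (localize_ring W R) (localize_module W R M)"
  unfolding torsion_free_def
proof (intro ballI inj_onI)
  let ?L = "localize_module W R M"
  fix p q q' assume p: "p \<in> nonzerodivisors (localize_ring W R)"
    and q: "q \<in> carrier ?L" "q' \<in> carrier ?L" "p \<odot>\<^bsub>?L\<^esub> q = p \<odot>\<^bsub>?L\<^esub> q'"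
  from p obtain a s b c w where a: "a \<in> carrier R" "s \<in> W" "p = fraction W R (regular_module R) a s"
    and b: "b \<in> nonzerodivisors R" "c \<in> carrier R" "w \<in> W" "w \<otimes> b = w \<otimes> (a \<otimes> c)"
    by (rule nonzerodivisor_localize_ringE[OF assms(1,2)])
  have bc: "b \<in> carrier R" using b by (simp add: nonzerodivisors_def)
  obtain x t where x: "x \<in> carrier M" "t \<in> W" "q = fraction W R M x t" using q(1) by (rule fraction_cases)
  obtain y r where y: "y \<in> carrier M" "r \<in> W" "q' = fraction W R M y r" using q(2) by (rule fraction_cases)
  obtain u where u: "u \<in> W" "u \<odot>\<^bsub>M\<^esub> ((s \<otimes> r) \<odot>\<^bsub>M\<^esub> (a \<odot>\<^bsub>M\<^esub> x)) = u \<odot>\<^bsub>M\<^esub> ((s \<otimes> t) \<odot>\<^bsub>M\<^esub> (a \<odot>\<^bsub>M\<^esub> y))"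
    using q(3) a x y by (auto simp: fraction_smult fraction_eq_iff)
  let ?v = "w \<otimes> (u \<otimes> s)"
  have "b \<odot>\<^bsub>M\<^esub> (?v \<odot>\<^bsub>M\<^esub> (r' \<odot>\<^bsub>M\<^esub> z)) = w \<odot>\<^bsub>M\<^esub> (c \<odot>\<^bsub>M\<^esub> (u \<odot>\<^bsub>M\<^esub> ((s \<otimes> r') \<odot>\<^bsub>M\<^esub> (a \<odot>\<^bsub>M\<^esub> z))))"
    if "r' \<in> W" "z \<in> carrier M" for r' z
  proof -
    have "b \<odot>\<^bsub>M\<^esub> (?v \<odot>\<^bsub>M\<^esub> (r' \<odot>\<^bsub>M\<^esub> z)) = u \<odot>\<^bsub>M\<^esub> (s \<odot>\<^bsub>M\<^esub> (r' \<odot>\<^bsub>M\<^esub> ((w \<otimes> b) \<odot>\<^bsub>M\<^esub> z)))"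
      using that a bc b(3) u(1) by (simp add: smult_assoc1 smult_left_commute)
    also have "\<dots> = w \<odot>\<^bsub>M\<^esub> (c \<odot>\<^bsub>M\<^esub> (u \<odot>\<^bsub>M\<^esub> ((s \<otimes> r') \<odot>\<^bsub>M\<^esub> (a \<odot>\<^bsub>M\<^esub> z))))"
      unfolding b(4) using that a b(2,3) u(1) by (simp add: smult_assoc1 smult_left_commute)
    finally show ?thesis .
  qed
  then have "b \<odot>\<^bsub>M\<^esub> (?v \<odot>\<^bsub>M\<^esub> (r \<odot>\<^bsub>M\<^esub> x)) = b \<odot>\<^bsub>M\<^esub> (?v \<odot>\<^bsub>M\<^esub> (t \<odot>\<^bsub>M\<^esub> y))"
    using u(2) x y by simp
  moreover have "inj_on (\<lambda>z. b \<odot>\<^bsub>M\<^esub> z) (carrier M)"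
    using assms(3) b(1) by (simp add: torsion_free_def)
  ultimately have "?v \<odot>\<^bsub>M\<^esub> (r \<odot>\<^bsub>M\<^esub> x) = ?v \<odot>\<^bsub>M\<^esub> (t \<odot>\<^bsub>M\<^esub> y)"
    using inj_on_eq_iff[of "\<lambda>z. b \<odot>\<^bsub>M\<^esub> z" "carrier M" "?v \<odot>\<^bsub>M\<^esub> (r \<odot>\<^bsub>M\<^esub> x)" "?v \<odot>\<^bsub>M\<^esub> (t \<odot>\<^bsub>M\<^esub> y)"]
      b(3) a(2) u(1) x(1,2) y(1,2) by simp
  moreover have "?v \<in> W" using a(2) b(3) u(1) by simp
  ultimately show "q = q'" using x y by (auto simp: fraction_eq_iff)
qed

end

section \<open>h-divisible modules as quotients of divisible torsion-free modules\<close>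

lemma module_hom_add:
  "\<lbrakk>f \<in> module_hom A M N; x \<in> carrier M; y \<in> carrier M\<rbrakk> \<Longrightarrow> f (x \<oplus>\<^bsub>M\<^esub> y) = f x \<oplus>\<^bsub>N\<^esub> f y"
  and module_hom_smult:
  "\<lbrakk>f \<in> module_hom A M N; a \<in> carrier A; x \<in> carrier M\<rbrakk> \<Longrightarrow> f (a \<odot>\<^bsub>M\<^esub> x) = a \<odot>\<^bsub>N\<^esub> f x"
  and module_hom_closed: "\<lbrakk>f \<in> module_hom A M N; x \<in> carrier M\<rbrakk> \<Longrightarrow> f x \<in> carrier N"
  by (auto simp: module_hom_def)

lemma module_hom_comp:
  assumes "f \<in> module_hom A M N" "g \<in> module_hom A N K"
  shows "(\<lambda>x. g (f x)) \<in> module_hom A M K"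
  using assms by (auto simp: module_hom_def Pi_iff)

lemma module_hom_inv_into:
  assumes "module A M" and f: "f \<in> module_hom A M N" and bij: "bij_betw f (carrier M) (carrier N)"
  shows "inv_into (carrier M) f \<in> module_hom A N M"
proof -
  interpret module A M by fact
  let ?g = "inv_into (carrier M) f"
  have g: "?g y \<in> carrier M" "f (?g y) = y" if "y \<in> carrier N" for y
    using bij that by (auto simp: bij_betw_def inv_into_into f_inv_into_f)
  have gf: "?g (f x) = x" if "x \<in> carrier M" for x
    using bij that by (simp add: bij_betw_def)
  have "?g (x \<oplus>\<^bsub>N\<^esub> y) = ?g x \<oplus>\<^bsub>M\<^esub> ?g y" if "x \<in> carrier N" "y \<in> carrier N" for x y
    using gf[of "?g x \<oplus>\<^bsub>M\<^esub> ?g y"] that by (simp add: g module_hom_add[OF f])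
  moreover have "?g (a \<odot>\<^bsub>N\<^esub> x) = a \<odot>\<^bsub>M\<^esub> ?g x" if "a \<in> carrier A" "x \<in> carrier N" for a x
    using gf[of "a \<odot>\<^bsub>M\<^esub> ?g x"] that by (simp add: g module_hom_smult[OF f])
  ultimately show ?thesis using g by (simp add: module_hom_def)
qed

lemma module_restrict_scalars:
  assumes "cring A" "module Q F" "h \<in> ring_hom A Q"
  shows "module A (restrict_scalars h F)"
proof -
  interpret A: cring A by fact
  interpret F: module Q F by fact
  note h = ring_hom_closed[OF assms(3)] ring_hom_mult[OF assms(3)] ring_hom_add[OF assms(3)]
    ring_hom_one[OF assms(3)]
  show ?thesis
  proof (rule moduleI[OF assms(1)])
    show "abelian_group (restrict_scalars h F)"
      by (rule abelian_group_transfer[OF F.M.abelian_group_axioms]) (simp_all add: restrict_scalars_def)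
  qed (simp_all add: restrict_scalars_def h F.smult_l_distr F.smult_r_distr F.smult_assoc1)
qed

lemma to_total_quotient_ring_hom:
  assumes "cring A" shows "to_total_quotient_ring A \<in> ring_hom A (total_quotient_ring A)"
proof -
  interpret module_fractions A "regular_module A" "nonzerodivisors A"
    using assms by (rule module_fractions_nonzerodivisors)
  have [simp]: "add (regular_module A) = add A" by (simp add: regular_module_def)
  show ?thesis
    by (rule ring_hom_memI)
      (simp_all add: to_total_quotient_ring_def total_quotient_ring_def localize_ring_def
        fraction_add fraction_smult)
qed

lemma to_total_quotient_ring_inverse:
  assumes "cring A" "a \<in> nonzerodivisors A"
  shows "\<exists>q\<in>carrier (total_quotient_ring A).
    q \<otimes>\<^bsub>total_quotient_ring A\<^esub> to_total_quotient_ring A a = \<one>\<^bsub>total_quotient_ring A\<^esub>"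
proof -
  interpret module_fractions A "regular_module A" "nonzerodivisors A"
    using assms(1) by (rule module_fractions_nonzerodivisors)
  let ?q = "fraction (nonzerodivisors A) A (regular_module A) \<one>\<^bsub>A\<^esub> a"
  have "fraction (nonzerodivisors A) A (regular_module A) a a =
      fraction (nonzerodivisors A) A (regular_module A) \<one>\<^bsub>A\<^esub> \<one>\<^bsub>A\<^esub>"
    using assms(2) by (intro fraction_cong) simp_all
  then show ?thesis
    using assms(2)
    by (intro bexI[of _ ?q])
      (simp_all add: to_total_quotient_ring_def total_quotient_ring_def localize_ring_def fraction_smult)
qed

text \<open>Each non-zerodivisor of \<open>A\<close> acts through a unit of \<open>Q(A)\<close>, hence bijectively.\<close>

lemma divisible_torsion_free_restrict_total_quotient_ring:
  assumes A: "cring A" and F: "module (total_quotient_ring A) F"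
  defines "N \<equiv> restrict_scalars (to_total_quotient_ring A) F"
  shows "divisible A N" "torsion_free A N"
proof -
  let ?Q = "total_quotient_ring A" and ?j = "to_total_quotient_ring A"
  interpret F: module ?Q F by (rule F)
  have j: "?j a \<in> carrier ?Q" if "a \<in> nonzerodivisors A" for a
    using that by (intro to_total_quotient_ring_closed[OF A]) (simp add: nonzerodivisors_def)
  have inv: "\<exists>q\<in>carrier ?Q. \<forall>x\<in>carrier F. q \<odot>\<^bsub>F\<^esub> (?j a \<odot>\<^bsub>F\<^esub> x) = x \<and> ?j a \<odot>\<^bsub>F\<^esub> (q \<odot>\<^bsub>F\<^esub> x) = x"
    if a: "a \<in> nonzerodivisors A" for a
  proof -
    obtain q where "q \<in> carrier ?Q" "q \<otimes>\<^bsub>?Q\<^esub> ?j a = \<one>\<^bsub>?Q\<^esub>"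
      using to_total_quotient_ring_inverse[OF A a] by blast
    then show ?thesis
      using j[OF a] F.R.m_comm[of q "?j a"]
      by (intro bexI[of _ q]) (auto simp flip: F.smult_assoc1)
  qed
  show "divisible A N"
    unfolding divisible_def
  proof (intro ballI equalityI subsetI)
    fix a y assume a: "a \<in> nonzerodivisors A"
    show "y \<in> carrier N" if "y \<in> (\<lambda>x. a \<odot>\<^bsub>N\<^esub> x) ` carrier N"
      using that j[OF a] by (auto simp: N_def restrict_scalars_def)
    assume y: "y \<in> carrier N"
    obtain q where q: "q \<in> carrier ?Q" "\<forall>x\<in>carrier F. ?j a \<odot>\<^bsub>F\<^esub> (q \<odot>\<^bsub>F\<^esub> x) = x"
      using inv[OF a] by blast
    show "y \<in> (\<lambda>x. a \<odot>\<^bsub>N\<^esub> x) ` carrier N"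
      using y q by (intro image_eqI[of _ _ "q \<odot>\<^bsub>F\<^esub> y"]) (auto simp: N_def restrict_scalars_def)
  qed
  show "torsion_free A N"
    unfolding torsion_free_def
  proof (intro ballI inj_onI)
    fix a x y assume a: "a \<in> nonzerodivisors A" and xy: "x \<in> carrier N" "y \<in> carrier N" "a \<odot>\<^bsub>N\<^esub> x = a \<odot>\<^bsub>N\<^esub> y"
    obtain q where q: "\<forall>x\<in>carrier F. q \<odot>\<^bsub>F\<^esub> (?j a \<odot>\<^bsub>F\<^esub> x) = x"
      using inv[OF a] by blast
    have "x \<in> carrier F" "y \<in> carrier F" "?j a \<odot>\<^bsub>F\<^esub> x = ?j a \<odot>\<^bsub>F\<^esub> y"
      using xy by (simp_all add: N_def restrict_scalars_def)
    then show "x = y" using q by metis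
  qed
qed

lemma (in module_fractions) localization_map_hom:
  "(\<lambda>x. fraction W R M x \<one>) \<in>
    module_hom R M (restrict_scalars (\<lambda>a. fraction W R (regular_module R) a \<one>) (localize_module W R M))"
  by (auto simp: module_hom_def restrict_scalars_def fraction_add fraction_smult)

lemma (in module_fractions) localization_map_bij:
  assumes "\<And>s. s \<in> W \<Longrightarrow> bij_betw (\<lambda>x. s \<odot>\<^bsub>M\<^esub> x) (carrier M) (carrier M)"
  shows "bij_betw (\<lambda>x. fraction W R M x \<one>) (carrier M) (carrier (localize_module W R M))"
  unfolding bij_betw_def
proof (intro conjI inj_onI equalityI subsetI)
  fix x y assume xy: "x \<in> carrier M" "y \<in> carrier M" "fraction W R M x \<one> = fraction W R M y \<one>"
  then obtain u where u: "u \<in> W" "u \<odot>\<^bsub>M\<^esub> x = u \<odot>\<^bsub>M\<^esub> y"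
    by (auto simp: fraction_eq_iff)
  then show "x = y" using assms[OF u(1)] xy by (auto simp: bij_betw_def dest: inj_onD)
next
  fix p assume "p \<in> carrier (localize_module W R M)"
  then obtain x s where x: "x \<in> carrier M" "s \<in> W" "p = fraction W R M x s" by (rule fraction_cases)
  then have "x \<in> (\<lambda>y. s \<odot>\<^bsub>M\<^esub> y) ` carrier M" using assms[OF x(2)] by (simp add: bij_betw_def)
  then obtain y where y: "y \<in> carrier M" "x = s \<odot>\<^bsub>M\<^esub> y" by blast
  have "fraction W R M x s = fraction W R M y \<one>" using x y by (intro fraction_cong) simp_all
  then have "p = fraction W R M y \<one>" using x(3) by simp
  then show "p \<in> (\<lambda>x. fraction W R M x \<one>) ` carrier M" using y by blast
qed auto

text \<open>For \<open>F\<close> serves the free \<open>Q(A)\<close>-module of which \<open>N\<close> is a quotient, regarded as an \<open>A\<close>-module.\<close>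

lemma h_divisibleE:
  fixes A :: "('a, 'm) ring_scheme" and N :: "('a, 'b, 'n) module_scheme"
  assumes "cring A" "h_divisible A N"
  obtains F :: "('a, 'b \<Rightarrow> ('a \<times> 'a) set) module" and f
  where "module A F" "divisible A F" "torsion_free A F" "f \<in> module_hom A F N" "f ` carrier F = carrier N"
proof -
  let ?Q = "total_quotient_ring A" and ?j = "to_total_quotient_ring A"
  obtain I :: "'b set" and f where f: "f \<in> module_hom A (restrict_scalars ?j (free_module ?Q I)) N"
    "f ` carrier (free_module ?Q I) = carrier N"
    using assms(2) unfolding h_divisible_def by blast
  have V: "module ?Q (free_module ?Q I)"
    by (rule module_free_module[OF cring_total_quotient_ring[OF assms(1)]])
  show thesis
    by (rule that[OF module_restrict_scalars[OF assms(1) V to_total_quotient_ring_hom[OF assms(1)]]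
          divisible_torsion_free_restrict_total_quotient_ring[OF assms(1) V] f(1)])
      (simp add: restrict_scalars_def f(2))
qed

text \<open>The non-zerodivisors of \<open>A\<close> act bijectively on \<open>F\<close>, so \<open>F\<close> is isomorphic to its localization at
  them, which is a \<open>Q(A)\<close>-module.\<close>

lemma h_divisible_if_quotient:
  assumes A: "cring A" and N: "module A N" and F: "module A F" "divisible A F" "torsion_free A F"
    and f: "f \<in> module_hom A F N" "f ` carrier F = carrier N"
  shows "h_divisible A N"
proof -
  let ?S = "nonzerodivisors A"
  interpret module_fractions A F ?S
    using F(1) submonoid_nonzerodivisors[OF A] by (rule module_fractions.intro)
  let ?G = "localize_module ?S A F" and ?i = "\<lambda>x. fraction ?S A F x \<one>\<^bsub>A\<^esub>"
  let ?g = "inv_into (carrier F) ?i"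
  have bij: "bij_betw ?i (carrier F) (carrier ?G)"
    by (rule localization_map_bij)
      (use F(2,3) in \<open>auto simp: divisible_def torsion_free_def bij_betw_def\<close>)
  have j: "(\<lambda>a. fraction ?S A (regular_module A) a \<one>\<^bsub>A\<^esub>) = to_total_quotient_ring A"
    by (simp add: fun_eq_iff to_total_quotient_ring_def)
  have "?g \<in> module_hom A (restrict_scalars (to_total_quotient_ring A) ?G) F"
    using module_hom_inv_into[OF F(1) localization_map_hom] bij
    by (simp add: j restrict_scalars_def)
  then have "(\<lambda>p. f (?g p)) \<in> module_hom A (restrict_scalars (to_total_quotient_ring A) ?G) N"
    using f(1) by (rule module_hom_comp)
  moreover have "(\<lambda>p. f (?g p)) ` carrier ?G = carrier N"
    using f(2) bij_betw_imp_surj_on[OF bij_betw_inv_into[OF bij]] by (simp flip: image_image)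
  moreover have "module (total_quotient_ring A) ?G"
    unfolding total_quotient_ring_def by (rule module_localize_module)
  ultimately show ?thesis by (intro h_divisibleI[OF A N])
qed

section \<open>h-divisible modules under localization\<close>

lemma localize_surjective_hom:
  assumes "module R M" "module R N" "submonoid W R"
    and f: "f \<in> module_hom R M N" "f ` carrier M = carrier N"
  obtains g where "g \<in> module_hom (localize_ring W R) (localize_module W R M) (localize_module W R N)"
    "g ` carrier (localize_module W R M) = carrier (localize_module W R N)"
proof -
  interpret M: module_fractions R M W using assms(1,3) by (rule module_fractions.intro)
  interpret N: module_fractions R N W using assms(2,3) by (rule module_fractions.intro)
  interpret S: module_fractions R "regular_module R" W by (rule M.regular)
  note hom = module_hom_add[OF f(1)] module_hom_smult[OF f(1)] module_hom_closed[OF f(1)]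
  \<comment> \<open>\<open>x/s\<close> goes to \<open>(f x)/s\<close>; the union runs over all representatives, which give the same value\<close>
  define g where "g p = (\<Union>(x, s)\<in>p. fraction W R N (f x) s)" for p
  have g: "g (fraction W R M x s) = fraction W R N (f x) s" if x: "x \<in> carrier M" "s \<in> W" for x s
  proof -
    have "fraction W R N (f y) t = fraction W R N (f x) s" if yt: "(y, t) \<in> fraction W R M x s" for y t
    proof -
      obtain u where u: "y \<in> carrier M" "t \<in> W" "u \<in> W" "u \<odot>\<^bsub>M\<^esub> (s \<odot>\<^bsub>M\<^esub> y) = u \<odot>\<^bsub>M\<^esub> (t \<odot>\<^bsub>M\<^esub> x)"
        by (rule M.in_fractionE[OF yt x])
      have "u \<odot>\<^bsub>N\<^esub> (s \<odot>\<^bsub>N\<^esub> f y) = f (u \<odot>\<^bsub>M\<^esub> (s \<odot>\<^bsub>M\<^esub> y))"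
        using u(1-3) x by (simp add: hom)
      also have "\<dots> = u \<odot>\<^bsub>N\<^esub> (t \<odot>\<^bsub>N\<^esub> f x)"
        unfolding u(4) using u(1-3) x by (simp add: hom)
      finally show ?thesis using u(1-3) x by (auto simp: N.fraction_eq_iff hom)
    qed
    then have "g (fraction W R M x s) = (\<Union>(y, t)\<in>fraction W R M x s. fraction W R N (f x) s)"
      unfolding g_def by (intro SUP_cong refl) auto
    then show ?thesis using M.fraction_self[OF x] by auto
  qed
  have "g \<in> module_hom (localize_ring W R) (localize_module W R M) (localize_module W R N)"
    unfolding module_hom_def
  proof (intro CollectI conjI Pi_I ballI)
    fix p assume "p \<in> carrier (localize_module W R M)"
    then obtain x s where p: "x \<in> carrier M" "s \<in> W" "p = fraction W R M x s" by (rule M.fraction_cases)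
    show "g p \<in> carrier (localize_module W R N)" using p by (simp add: g hom)
    show "g (p \<oplus>\<^bsub>localize_module W R M\<^esub> q) = g p \<oplus>\<^bsub>localize_module W R N\<^esub> g q"
      if "q \<in> carrier (localize_module W R M)" for q
      using that p by (elim M.fraction_cases) (simp add: g hom M.fraction_add N.fraction_add)
    show "g (a \<odot>\<^bsub>localize_module W R M\<^esub> p) = a \<odot>\<^bsub>localize_module W R N\<^esub> g p"
      if "a \<in> carrier (localize_ring W R)" for a
    proof -
      have "a \<in> carrier (localize_module W R (regular_module R))"
        using that by (simp add: localize_ring_def)
      then show ?thesis
        using p by (elim S.fraction_cases) (simp add: g hom M.fraction_smult N.fraction_smult)
    qed
  qed
  moreover have "g ` carrier (localize_module W R M) = carrier (localize_module W R N)"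
  proof (intro equalityI subsetI)
    fix q assume "q \<in> carrier (localize_module W R N)"
    then obtain y s where q: "y \<in> carrier N" "s \<in> W" "q = fraction W R N y s" by (rule N.fraction_cases)
    then obtain x where "x \<in> carrier M" "y = f x" using f(2) by blast
    then show "q \<in> g ` carrier (localize_module W R M)"
      using q by (intro image_eqI[of _ _ "fraction W R M x s"]) (simp_all add: g)
  qed (use calculation in \<open>auto simp: module_hom_def\<close>)
  ultimately show thesis by (rule that)
qed

lemma h_divisible_localize_module:
  fixes R :: "('a, 'm) ring_scheme" and M :: "('a, 'b, 'n) module_scheme"
  assumes "cring R" "noetherian_ring R" "no_embedded_primes R" "module R M" "submonoid W R"
    and "h_divisible R M"
  shows "h_divisible (localize_ring W R) (localize_module W R M)"
proof -
  interpret M: module_fractions R M W using assms(4,5) by (rule module_fractions.intro)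
  obtain F :: "('a, 'b \<Rightarrow> ('a \<times> 'a) set) module" and f
    where F: "module R F" "divisible R F" "torsion_free R F"
      and f: "f \<in> module_hom R F M" "f ` carrier F = carrier M"
    by (rule h_divisibleE[OF assms(1,6)])
  interpret F: module_fractions R F W using F(1) assms(5) by (rule module_fractions.intro)
  obtain g where "g \<in> module_hom (localize_ring W R) (localize_module W R F) (localize_module W R M)"
    "g ` carrier (localize_module W R F) = carrier (localize_module W R M)"
    by (rule localize_surjective_hom[OF F(1) assms(4,5) f])
  then show ?thesis
    by (rule h_divisible_if_quotient[OF M.cring_localize_ring M.module_localize_module
          F.module_localize_module F.divisible_localize_module[OF assms(2,3) F(2)]
          F.torsion_free_localize_module[OF assms(2,3) F(3)]])
qed

theorem proposition4p7:
  fixes R :: "('a, 'm) ring_scheme" and M :: "('a, 'b, 'n) module_scheme" and W :: "'a set"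
  assumes "cring R" and "noetherian_ring R" and "no_embedded_primes R"
    and "module R M" and "submonoid W R"
  shows "(divisible R M \<longrightarrow> divisible (localize_ring W R) (localize_module W R M)) \<and>
    (h_divisible R M \<longrightarrow> h_divisible (localize_ring W R) (localize_module W R M))"
proof -
  interpret module_fractions R M W using assms(4,5) by (rule module_fractions.intro)
  show ?thesis
    using divisible_localize_module[OF assms(2,3)] h_divisible_localize_module[OF assms] by blast
qed

end
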